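(* Let $\mathbb G$ be a group of Heisenberg type with homogeneous dimension $Q=m+2k$, and let $\rho\in C_0(\mathbb G)$ with $\rho\ge 0$. For a real number $\alpha<Q$, $\alpha\neq 0$, set $$F_\alpha(g)=\int_{\mathbb G}\frac{\rho(g')}{N(g^{-1}g')^{\alpha}}\,dg'$$ (this is the Riesz potential $R_{Q-\alpha}(\rho)$), and set $$F_0(g)=R_Q(\rho)(g)=\int_{\mathbb G}\rho(g')\log N(g^{-1}g')\,dg'.$$ Then: 1) If $2<p<Q$ and $0<\alpha\le \frac{Q-p}{p-1}$, then $F_\alpha$ is $p$-superharmonic, i.e. $\mathcal L_pF_\alpha\le 0$ on $\mathbb G$. 2) If $p>Q$ and $-\alpha\ge\frac{p-Q}{p-1}$, then $F_\alpha$ is $p$-subharmonic, i.e. $\mathcal L_pF_\alpha\ge 0$ on $\mathbb G$. In the case $p=\infty$ the same conclusion holds, namely $\mathcal L_\infty F_\alpha\ge 0$ on $\mathbb G$, whenever $-\alpha\ge 1$. 3) If $p=Q$, then $F_0=R_Q(\rho)$ is $Q$-subharmonic, i.e. $\mathcal L_QF_0\ge 0$ on $\mathbb G$.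
   Context: A Carnot group of step two is a connected, simply connected Lie group $\mathbb G$ whose Lie algebra is $\mathfrak g=V_1\oplus V_2$ with $[V_1,V_1]=V_2$ and $[V_1,V_2]=\{0\}$. The Lie algebra $\mathfrak g$ carries an inner product $\langle\cdot,\cdot\rangle$ for which $V_1\perp V_2$. Let $m=\dim V_1$, $k=\dim V_2$, and let $\{e_1,\dots,e_m\}$ and $\{\varepsilon_1,\dots,\varepsilon_k\}$ be orthonormal bases of $V_1$ and $V_2$. The left-invariant vector fields are $X_i(g)=dL_g(e_i)$, where $L_g(g')=gg'$. Points are written in exponential (logarithmic) coordinates $g=\exp(z+t)$, with $z=\sum z_ie_i\in V_1$ and $t=\sum t_s\varepsilon_s\in V_2$; group multiplication is $\exp(z+t)\exp(z'+t')=\exp(z+z'+t+t'+\tfrac12[z,z'])$. Define $J:V_2\to\mathrm{End}(V_1)$ by $\langle J(t)z,z'\rangle=\langle[z,z'],t\rangle$. The group $\mathbb G$ is of Heisenberg type if $J(t)$ is an orthogonal transformation of $V_1$ for every $t\in V_2$ with $|t|=1$. The homogeneous dimension is $Q=m+2k$, and $dg$ denotes Haar measure, i.e. the push-forward of Lebesgue measure on $\mathfrak g$ under $\exp$. The Folland–Kaplan gauge is $N(g)=(|z|^4+16|t|^2)^{1/4}$. For a smooth $u$, the horizontal gradient is $Xu=\sum_i (X_iu)X_i$, with $|Xu|=(\sum_i (X_iu)^2)^{1/2}$, and the symmetrized horizontal Hessian has entries $u_{,ij}=\tfrac12(X_iX_ju+X_jX_iu)$. The horizontal $p$-Laplacian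 is $\mathcal L_pu=\sum_{i=1}^m X_i(|Xu|^{p-2}X_iu)$, and the horizontal $\infty$-Laplacian is $\mathcal L_\infty u=\sum_{i,j}u_{,ij}X_iuX_ju$. For $p>2$ and sufficiently smooth $u$, "$p$-superharmonic" means $\mathcal L_pu\le 0$ and "$p$-subharmonic" means $\mathcal L_pu\ge0$, with derivatives taken in the strong sense. *)

theory Defs
  imports "HOL-Analysis.Analysis"
begin

text \<open>Step-two Carnot group in exponential coordinates: a point is a pair (z,t) with
  z in V1 = real^'m and t in V2 = real^'k (orthonormal coordinates).
  The bracket [V1,V1] is given by a bilinear skew map B.\<close>

definition Jmap :: "(real^'m \<Rightarrow> real^'m \<Rightarrow> real^'k) \<Rightarrow> real^'k \<Rightarrow> real^'m \<Rightarrow> real^'m" where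
  "Jmap B t z = (\<chi> i. inner (B z (axis i 1)) t)"

definition carnot_step2 :: "(real^'m \<Rightarrow> real^'m \<Rightarrow> real^'k) \<Rightarrow> bool" where
  "carnot_step2 B \<longleftrightarrow> bilinear B \<and> (\<forall>z z'. B z z' = - B z' z)
     \<and> span (range (case_prod B)) = UNIV"

definition heisenberg_type :: "(real^'m \<Rightarrow> real^'m \<Rightarrow> real^'k) \<Rightarrow> bool" where
  "heisenberg_type B \<longleftrightarrow> carnot_step2 B \<and>
     (\<forall>t. norm t = 1 \<longrightarrow> orthogonal_transformation (Jmap B t))"

definition gmul :: "(real^'m \<Rightarrow> real^'m \<Rightarrow> real^'k) \<Rightarrow> ((real^'m) \<times> (real^'k)) \<Rightarrow> ((real^'m) \<times> (real^'k)) \<Rightarrow> ((real^'m) \<times> (real^'k))" where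
  "gmul B g h = (fst g + fst h, snd g + snd h + (1/2) *\<^sub>R B (fst g) (fst h))"

definition ginv :: "((real^'m) \<times> (real^'k)) \<Rightarrow> ((real^'m) \<times> (real^'k))" where
  "ginv g = (- fst g, - snd g)"

definition gauge :: "((real^'m) \<times> (real^'k)) \<Rightarrow> real" where
  "gauge g = ((norm (fst g))^4 + 16 * (norm (snd g))^2) powr (1/4)"

definition hom_dim :: "(real^'m \<Rightarrow> real^'m \<Rightarrow> real^'k) \<Rightarrow> real" where
  "hom_dim B = real (CARD('m) + 2 * CARD('k))"

text \<open>Left-invariant vector field X_i applied to u: derivative along s \<mapsto> g exp(s e_i).\<close>
definition hcurve :: "(real^'m \<Rightarrow> real^'m \<Rightarrow> real^'k) \<Rightarrow> ((real^'m) \<times> (real^'k) \<Rightarrow> real) \<Rightarrow> ((real^'m) \<times> (real^'k)) \<Rightarrow> 'm \<Rightarrow> real \<Rightarrow> real" where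
  "hcurve B u g i = (\<lambda>s. u (gmul B g (s *\<^sub>R axis i 1, 0)))"

definition Xf :: "(real^'m \<Rightarrow> real^'m \<Rightarrow> real^'k) \<Rightarrow> 'm \<Rightarrow> ((real^'m) \<times> (real^'k) \<Rightarrow> real) \<Rightarrow> ((real^'m) \<times> (real^'k) \<Rightarrow> real)" where
  "Xf B i u g = deriv (hcurve B u g i) 0"

definition hdiff :: "(real^'m \<Rightarrow> real^'m \<Rightarrow> real^'k) \<Rightarrow> 'm \<Rightarrow> ((real^'m) \<times> (real^'k) \<Rightarrow> real) \<Rightarrow> ((real^'m) \<times> (real^'k)) \<Rightarrow> bool" where
  "hdiff B i u g \<longleftrightarrow> hcurve B u g i differentiable (at 0)"

definition hgrad_norm :: "(real^'m \<Rightarrow> real^'m \<Rightarrow> real^'k) \<Rightarrow> ((real^'m) \<times> (real^'k) \<Rightarrow> real) \<Rightarrow> ((real^'m) \<times> (real^'k) \<Rightarrow> real)" where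
  "hgrad_norm B u g = sqrt (\<Sum>i\<in>UNIV. (Xf B i u g)^2)"

definition p_flux :: "(real^'m \<Rightarrow> real^'m \<Rightarrow> real^'k) \<Rightarrow> real \<Rightarrow> ((real^'m) \<times> (real^'k) \<Rightarrow> real) \<Rightarrow> 'm \<Rightarrow> ((real^'m) \<times> (real^'k) \<Rightarrow> real)" where
  "p_flux B p u i = (\<lambda>h. (hgrad_norm B u h) powr (p - 2) * Xf B i u h)"

definition p_lap :: "(real^'m \<Rightarrow> real^'m \<Rightarrow> real^'k) \<Rightarrow> real \<Rightarrow> ((real^'m) \<times> (real^'k) \<Rightarrow> real) \<Rightarrow> ((real^'m) \<times> (real^'k) \<Rightarrow> real)" where
  "p_lap B p u g = (\<Sum>i\<in>UNIV. Xf B i (p_flux B p u i) g)"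

definition inf_lap :: "(real^'m \<Rightarrow> real^'m \<Rightarrow> real^'k) \<Rightarrow> ((real^'m) \<times> (real^'k) \<Rightarrow> real) \<Rightarrow> ((real^'m) \<times> (real^'k) \<Rightarrow> real)" where
  "inf_lap B u g = (\<Sum>i\<in>UNIV. \<Sum>j\<in>UNIV.
      (1/2) * (Xf B i (Xf B j u) g + Xf B j (Xf B i u) g) * Xf B i u g * Xf B j u g)"

definition p_superharmonic :: "(real^'m \<Rightarrow> real^'m \<Rightarrow> real^'k) \<Rightarrow> real \<Rightarrow> ((real^'m) \<times> (real^'k) \<Rightarrow> real) \<Rightarrow> bool" where
  "p_superharmonic B p u \<longleftrightarrow> (\<forall>g. (\<forall>i. hdiff B i u g \<and> hdiff B i (p_flux B p u i) g) \<and> p_lap B p u g \<le> 0)"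

definition p_subharmonic :: "(real^'m \<Rightarrow> real^'m \<Rightarrow> real^'k) \<Rightarrow> real \<Rightarrow> ((real^'m) \<times> (real^'k) \<Rightarrow> real) \<Rightarrow> bool" where
  "p_subharmonic B p u \<longleftrightarrow> (\<forall>g. (\<forall>i. hdiff B i u g \<and> hdiff B i (p_flux B p u i) g) \<and> p_lap B p u g \<ge> 0)"

definition inf_subharmonic :: "(real^'m \<Rightarrow> real^'m \<Rightarrow> real^'k) \<Rightarrow> ((real^'m) \<times> (real^'k) \<Rightarrow> real) \<Rightarrow> bool" where
  "inf_subharmonic B u \<longleftrightarrow> (\<forall>g. (\<forall>i j. hdiff B i u g \<and> hdiff B i (Xf B j u) g) \<and> inf_lap B u g \<ge> 0)"

text \<open>Riesz-type potentials; Haar measure = Lebesgue measure in exponential coordinates.\<close>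
definition F_alpha :: "(real^'m \<Rightarrow> real^'m \<Rightarrow> real^'k) \<Rightarrow> ((real^'m) \<times> (real^'k) \<Rightarrow> real) \<Rightarrow> real \<Rightarrow> ((real^'m) \<times> (real^'k) \<Rightarrow> real)" where
  "F_alpha B \<rho> \<alpha> g = (\<integral>g'. \<rho> g' / (gauge (gmul B (ginv g) g')) powr \<alpha> \<partial>lborel)"

definition F_log :: "(real^'m \<Rightarrow> real^'m \<Rightarrow> real^'k) \<Rightarrow> ((real^'m) \<times> (real^'k) \<Rightarrow> real) \<Rightarrow> ((real^'m) \<times> (real^'k) \<Rightarrow> real)" where
  "F_log B \<rho> g = (\<integral>g'. \<rho> g' * ln (gauge (gmul B (ginv g) g')) \<partial>lborel)"

end

theory Submission
  imports Defs
begin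

text \<open>
  Write \<open>w = N\<^sup>4 = |z|\<^sup>4 + 16 |t|\<^sup>2\<close>. The kernel is a function \<open>f(w)\<close> with \<open>f' = c w\<^bsup>b-1\<^esup>\<close>, and its
  first and second horizontal derivatives are \<open>O(w\<^bsup>b-1/4\<^esup>)\<close> and \<open>O(w\<^bsup>b-1/2\<^esup>)\<close>, hence still locally
  integrable. The potential can therefore be differentiated twice under the integral although \<open>\<rho>\<close> is
  only continuous: almost every horizontal line misses the singularity, so Fubini and the fundamental
  theorem of calculus express increments of the potential along a line as integrals of a continuous
  function.

  At a fixed point put \<open>v = XF\<close>. Then \<open>\<L>\<^sub>p F = |v|\<^bsup>p-4\<^esup> (|v|\<^sup>2 tr F'' + (p - 2) F''(v,v))\<close> is linear in \<open>F''\<close>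
  once \<open>v\<close> is frozen, so its sign follows from a pointwise sign of the same quadratic expression for the
  kernel and every \<open>v\<close>. The identities \<open>|Xw|\<^sup>2 = 16 |z|\<^sup>2 w\<close>, \<open>tr w'' = 4 (Q + 2) |z|\<^sup>2\<close> and
  \<open>w''(v,v) = 8 \<langle>z,v\<rangle>\<^sup>2 + 4 |z|\<^sup>2 |v|\<^sup>2 + 8 |[z,v]|\<^sup>2\<close> together with Cauchy--Schwarz reduce that to an inequality
  affine in \<open>\<langle>Xw,v\<rangle>\<^sup>2\<close>, whose extreme case is \<open>Q - p + 4b(p - 1) \<ge> 0\<close>.
\<close>

section \<open>Measure-theoretic preliminaries\<close>

text \<open>By Tonelli it suffices to look at slices: with the first coordinate fixed, the map
  translates the second one. Left translations of the group have this form, because the bracket sees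
  only the first coordinates.\<close>

lemma distr_lborel_shear:
  fixes h :: "'a::euclidean_space \<Rightarrow> 'b::euclidean_space"
  assumes [measurable]: "h \<in> borel_measurable borel"
  shows "distr lborel lborel (\<lambda>x. (a + fst x, h (fst x) + snd x)) = lborel"
proof (rule measure_eqI)
  have T: "(\<lambda>x. (a + fst x, h (fst x) + snd x)) \<in> borel \<Otimes>\<^sub>M borel \<rightarrow>\<^sub>M borel \<Otimes>\<^sub>M borel"
    by measurable
  fix A :: "('a \<times> 'b) set"
  assume "A \<in> sets (distr lborel lborel (\<lambda>x. (a + fst x, h (fst x) + snd x)))"
  then have A[measurable]: "A \<in> sets (borel \<Otimes>\<^sub>M borel)"
    by (metis borel_prod sets_distr sets_lborel)
  then have A': "A \<in> sets borel"
    by (simp only: borel_prod)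
  have "emeasure (distr lborel lborel (\<lambda>x. (a + fst x, h (fst x) + snd x))) A
      = (\<integral>\<^sup>+ x. indicator A x \<partial>distr (lborel \<Otimes>\<^sub>M lborel) (lborel \<Otimes>\<^sub>M lborel) (\<lambda>x. (a + fst x, h (fst x) + snd x)))"
    by (subst nn_integral_indicator) (use A in \<open>simp_all only: borel_prod lborel_prod sets_distr sets_lborel\<close>)
  also have "\<dots> = (\<integral>\<^sup>+ x. indicator A (a + fst x, h (fst x) + snd x) \<partial>(lborel \<Otimes>\<^sub>M lborel))"
    by (subst nn_integral_distr) (use T A' in \<open>auto simp: borel_prod lborel_prod\<close>)
  also have "\<dots> = (\<integral>\<^sup>+ z. \<integral>\<^sup>+ t. indicator A (a + z, h z + t) \<partial>lborel \<partial>lborel)"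
    by (subst lborel.nn_integral_fst[symmetric]) auto
  also have "\<dots> = (\<integral>\<^sup>+ z. \<integral>\<^sup>+ t. indicator A (a + z, t) \<partial>lborel \<partial>lborel)"
  proof (rule nn_integral_cong)
    fix z
    have "(\<integral>\<^sup>+ t. indicator A (a + z, t) \<partial>lborel) = (\<integral>\<^sup>+ t. indicator A (a + z, t) \<partial>distr lborel borel ((+) (h z)))"
      by (simp add: lborel_distr_plus)
    also have "\<dots> = (\<integral>\<^sup>+ t. indicator A (a + z, h z + t) \<partial>lborel)"
      by (subst nn_integral_distr) auto
    finally show "(\<integral>\<^sup>+ t. indicator A (a + z, h z + t) \<partial>lborel) = (\<integral>\<^sup>+ t. indicator A (a + z, t) \<partial>lborel)" ..
  qed
  also have "\<dots> = (\<integral>\<^sup>+ z. \<integral>\<^sup>+ t. indicator A (z, t) \<partial>lborel \<partial>distr lborel borel ((+) a))"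
    by (subst nn_integral_distr) auto
  also have "\<dots> = (\<integral>\<^sup>+ x. indicator A x \<partial>(lborel \<Otimes>\<^sub>M lborel))"
    by (subst lborel.nn_integral_fst[symmetric]) (auto simp: lborel_distr_plus)
  also have "\<dots> = emeasure lborel A"
    using A' by (simp only: lborel_prod nn_integral_indicator sets_lborel)
  finally show "emeasure (distr lborel lborel (\<lambda>x. (a + fst x, h (fst x) + snd x))) A = emeasure lborel A" .
qed simp

lemma nn_integral_powr_symmetric_finite:
  fixes b R :: real
  assumes "b < 1" "0 \<le> R"
  shows "(\<integral>\<^sup>+ x. ennreal (indicator {-R..R} x * \<bar>x\<bar> powr (- b)) \<partial>lborel) < \<infinity>"
proof -
  let ?g = "\<lambda>x::real. ennreal (indicator {0..R} x * x powr (- b))"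
  have "((\<lambda>x. x powr (- b)) has_integral (R powr (- b + 1) / (- b + 1))) {0..R}"
    by (rule has_integral_powr_from_0) (use assms in auto)
  then have "((\<lambda>x. indicator {0..R} x * x powr (- b)) has_integral (R powr (- b + 1) / (- b + 1))) UNIV"
    by (subst (asm) has_integral_restrict_UNIV[symmetric])
      (erule has_integral_eq_rhs[OF has_integral_eq, rotated], auto)
  then have g: "(\<integral>\<^sup>+ x. ?g x \<partial>lborel) < \<infinity>"
    by (subst nn_integral_has_integral_lborel) auto
  have g': "(\<integral>\<^sup>+ x. ?g (- x) \<partial>lborel) = (\<integral>\<^sup>+ x. ?g x \<partial>lborel)"
  proof -
    have "(\<integral>\<^sup>+ x. ?g x \<partial>lborel) = (\<integral>\<^sup>+ x. ?g x \<partial>distr lborel borel uminus)"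
      by (simp add: lborel_distr_uminus)
    also have "\<dots> = (\<integral>\<^sup>+ x. ?g (- x) \<partial>lborel)"
      by (subst nn_integral_distr) auto
    finally show ?thesis ..
  qed
  have "(\<integral>\<^sup>+ x. ennreal (indicator {-R..R} x * \<bar>x\<bar> powr (- b)) \<partial>lborel) \<le> (\<integral>\<^sup>+ x. ?g x + ?g (- x) \<partial>lborel)"
    by (intro nn_integral_mono) (auto simp: indicator_def abs_if not_less simp flip: ennreal_plus intro!: ennreal_leI)
  also have "\<dots> = (\<integral>\<^sup>+ x. ?g x \<partial>lborel) + (\<integral>\<^sup>+ x. ?g (- x) \<partial>lborel)"
    by (intro nn_integral_add) auto
  also have "\<dots> < \<infinity>" using g g' by simp
  finally show ?thesis .
qed

text \<open>Finitely many hyperplanes are null. Off them the product of the coordinates is nonzero,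
  and so is the V2 component of a point.\<close>

lemma AE_lborel_coordinates_nonzero:
  "AE x::'a::euclidean_space in lborel. \<forall>b\<in>Basis. x \<bullet> b \<noteq> 0"
proof -
  have "AE x::'a in lborel. x \<bullet> b \<noteq> 0" if "b \<in> Basis" for b
  proof -
    have "{x::'a. b \<bullet> x = 0} \<in> null_sets lebesgue"
      using negligible_hyperplane[of b 0] that nonzero_Basis by (auto simp: negligible_iff_null_sets)
    moreover have "{x::'a. b \<bullet> x = 0} \<in> sets lborel"
      by (simp add: closed_hyperplane)
    ultimately have "{x::'a. b \<bullet> x = 0} \<in> null_sets lborel"
      by (simp add: null_sets_completion_iff)
    then show ?thesis
      by (rule AE_I') (auto simp: inner_commute)
  qed
  then show ?thesis
    by (subst AE_finite_all) auto
qed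

text \<open>Balls about the origin suffice because every compact set lies in one. Borel
  measurability is built in so that kernels stay measurable after composition with group
  translations.\<close>

definition loc_integrable :: "('a::euclidean_space \<Rightarrow> real) \<Rightarrow> bool" where
  "loc_integrable k \<longleftrightarrow> k \<in> borel_measurable borel \<and> (\<forall>R. integrable lborel (\<lambda>x. indicator (cball 0 R) x * k x))"

lemma loc_integrable_product_powr:
  fixes b :: real
  assumes "b < 1"
  shows "loc_integrable (\<lambda>x::'a::euclidean_space. \<Prod>i\<in>Basis. \<bar>x \<bullet> i\<bar> powr (- b))"
  unfolding loc_integrable_def
proof (intro conjI allI)
  fix R0 :: real
  \<comment> \<open>A negative radius gives an empty ball, whereas the one-variable integral is
    taken over an interval with nonnegative radius.\<close>
  define R where "R = max 0 R0"
  let ?f = "\<lambda>x::real. indicator {-R..R} x * \<bar>x\<bar> powr (- b)"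
  let ?k = "\<lambda>x::'a. \<Prod>i\<in>Basis. \<bar>x \<bullet> i\<bar> powr (- b)"
  show "integrable lborel (\<lambda>x. indicator (cball 0 R0) x * ?k x)"
  proof (rule integrableI_bounded)
    have "(\<integral>\<^sup>+ x. ennreal (norm (indicator (cball 0 R0) x * ?k x)) \<partial>lborel)
        \<le> (\<integral>\<^sup>+ x. (\<Prod>i\<in>Basis. ennreal (?f ((x::'a) \<bullet> i))) \<partial>lborel)"
    proof (intro nn_integral_mono)
      fix x :: 'a
      \<comment> \<open>Enlarging the ball to a cube turns the integrand into a product of
        one-variable functions.\<close>
      have "indicator (cball 0 R0) x * ?k x \<le> (\<Prod>i\<in>Basis. ?f (x \<bullet> i))"
      proof (cases "x \<in> cball 0 R0")
        case True
        have "x \<bullet> i \<in> {-R..R}" if "i \<in> Basis" for i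
          using Basis_le_norm[OF that, of x] True by (auto simp: R_def abs_le_iff)
        then show ?thesis using True by simp
      qed (auto intro!: prod_nonneg)
      then show "ennreal (norm (indicator (cball 0 R0) x * ?k x)) \<le> (\<Prod>i\<in>Basis. ennreal (?f (x \<bullet> i)))"
        by (subst prod_ennreal) (auto simp: prod_nonneg abs_mult abs_prod intro!: ennreal_leI)
    qed
    also have "\<dots> = (\<Prod>i\<in>(Basis::'a set). (\<integral>\<^sup>+ x. ennreal (?f x) \<partial>lborel))"
      by (rule nn_integral_lborel_prod) auto
    also have "\<dots> < \<infinity>"
      using nn_integral_powr_symmetric_finite[OF assms, of R]
      by (simp add: R_def power_less_top_ennreal)
    finally show "(\<integral>\<^sup>+ x. ennreal (norm (indicator (cball 0 R0) x * ?k x)) \<partial>lborel) < \<infinity>" .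
  qed (auto intro!: borel_measurable_times borel_measurable_indicator borel_measurable_prod)
qed measurable

lemma loc_integrable_bound:
  assumes "loc_integrable k" "k' \<in> borel_measurable borel" "AE x in lborel. \<bar>k' x\<bar> \<le> C * k x"
  shows "loc_integrable k'"
  unfolding loc_integrable_def
proof (intro conjI allI)
  fix R :: real
  have [measurable]: "k' \<in> borel_measurable borel" by fact
  show "integrable lborel (\<lambda>x. indicator (cball 0 R) x * k' x)"
  proof (rule Bochner_Integration.integrable_bound)
    show "integrable lborel (\<lambda>x. C * (indicator (cball 0 R) x * k x))"
      using assms(1) by (auto simp: loc_integrable_def)
    show "AE x in lborel. norm (indicator (cball 0 R) x * k' x) \<le> norm (C * (indicator (cball 0 R) x * k x))"
      using assms(3) by eventually_elim (auto simp: indicator_def)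
  qed (auto intro!: borel_measurable_times borel_measurable_indicator)
qed fact

lemma loc_integrable_add:
  "loc_integrable k \<Longrightarrow> loc_integrable k' \<Longrightarrow> loc_integrable (\<lambda>x. k x + k' x)"
  by (auto simp: loc_integrable_def distrib_left)

lemma loc_integrable_continuous:
  assumes "continuous_on UNIV k" shows "loc_integrable k"
  unfolding loc_integrable_def
proof (intro conjI allI)
  show "k \<in> borel_measurable borel" using assms by (rule borel_measurable_continuous_onI)
  fix R
  have "continuous_on (cball 0 R) k" using assms by (rule continuous_on_subset) simp
  from borel_integrable_compact[OF compact_cball this]
  show "integrable lborel (\<lambda>x. indicator (cball 0 R) x * k x)" by simp
qed

section \<open>Group law and potentials\<close>

lemma gmul_assoc:
  assumes "bilinear B"
  shows "gmul B (gmul B g h) x = gmul B g (gmul B h x)"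
  using assms
  by (simp add: gmul_def bilinear_ladd bilinear_radd scaleR_add_right add_ac)

lemma skew_diag:
  fixes B :: "'a \<Rightarrow> 'a \<Rightarrow> real^'k"
  assumes "\<And>z z'. B z z' = - B z' z"
  shows "B z z = 0"
proof -
  have "B z z $ i = - B z z $ i" for i
    by (metis assms vector_uminus_component)
  then show ?thesis by (simp add: vec_eq_iff)
qed

lemma gmul_0_left: "bilinear B \<Longrightarrow> gmul B 0 x = x"
  by (simp add: gmul_def bilinear_lzero)

lemma gmul_ginv_cancel:
  assumes "bilinear B" and skew: "\<And>z z'. B z z' = - B z' z"
  shows "gmul B (ginv g) (gmul B g x) = x" "gmul B g (gmul B (ginv g) x) = x"
proof -
  have 0: "B z z = 0" for z using skew by (rule skew_diag)
  have left: "gmul B (ginv h) h = 0" for h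
    using 0[of "fst h"] assms(1) by (simp add: gmul_def ginv_def bilinear_lneg prod_eq_iff)
  have "ginv (ginv g) = g" by (simp add: ginv_def)
  then show "gmul B (ginv g) (gmul B g x) = x" "gmul B g (gmul B (ginv g) x) = x"
    using left[of g] left[of "ginv g"] by (simp_all add: gmul_0_left assms(1) flip: gmul_assoc[OF assms(1)])
qed

lemma continuous_on_bilinear:
  fixes B :: "'a::euclidean_space \<Rightarrow> 'b::euclidean_space \<Rightarrow> 'c::real_normed_vector"
  assumes "bilinear B" "continuous_on S f" "continuous_on S g"
  shows "continuous_on S (\<lambda>x. B (f x) (g x))"
  using bounded_bilinear.continuous_on[OF _ assms(2,3)] assms(1) bilinear_conv_bounded_bilinear by blast

lemma continuous_on_gmul:
  assumes "bilinear B" "continuous_on S f" "continuous_on S g"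
  shows "continuous_on S (\<lambda>x. gmul B (f x) (g x))"
  unfolding gmul_def
  by (intro continuous_on_Pair continuous_on_add continuous_on_scaleR continuous_on_const continuous_on_fst continuous_on_snd
      continuous_on_bilinear[OF assms(1)] assms)

lemma borel_measurable_gmul:
  assumes "bilinear B" "f \<in> borel_measurable M" "g \<in> borel_measurable M"
  shows "(\<lambda>x. gmul B (f x) (g x)) \<in> borel_measurable M"
proof -
  have "continuous_on UNIV (\<lambda>x. gmul B (fst x) (snd x))"
    by (intro continuous_on_gmul[OF assms(1)] continuous_intros)
  from borel_measurable_continuous_on[OF this borel_measurable_Pair[OF assms(2,3)]]
  show ?thesis by simp
qed

lemma distr_lborel_gmul:
  assumes "bilinear B"
  shows "distr lborel lborel (gmul B g) = lborel"
proof -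
  have eq: "gmul B g = (\<lambda>x. (fst g + fst x, (snd g + (1/2) *\<^sub>R B (fst g) (fst x)) + snd x))"
    by (auto simp: gmul_def)
  have "(\<lambda>z. snd g + (1/2) *\<^sub>R B (fst g) z) \<in> borel_measurable borel"
    by (intro borel_measurable_continuous_onI continuous_on_add continuous_on_scaleR continuous_on_const
      continuous_on_bilinear[OF assms] continuous_on_id)
  from distr_lborel_shear[OF this, of "fst g"] show ?thesis by (simp only: eq)
qed

lemma measurable_gmul: "bilinear B \<Longrightarrow> gmul B g \<in> borel_measurable borel"
  by (rule borel_measurable_gmul) auto

lemma integral_gmul:
  fixes f :: "_ \<Rightarrow> real"
  assumes "bilinear B" "f \<in> borel_measurable borel"
  shows "(\<integral>x. f (gmul B g x) \<partial>lborel) = (\<integral>x. f x \<partial>lborel)"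
  using integral_distr[of "gmul B g" lborel lborel f] measurable_gmul[OF assms(1)] assms(2)
  by (simp add: distr_lborel_gmul[OF assms(1)])

lemma integrable_gmul_iff:
  fixes f :: "_ \<Rightarrow> real"
  assumes "bilinear B" "f \<in> borel_measurable borel"
  shows "integrable lborel (\<lambda>x. f (gmul B g x)) \<longleftrightarrow> integrable lborel f"
  using integrable_distr_eq[of "gmul B g" lborel lborel f] measurable_gmul[OF assms(1)] assms(2)
  by (simp add: distr_lborel_gmul[OF assms(1)])

section \<open>Horizontal one-parameter subgroups\<close>

definition hexp :: "'m \<Rightarrow> real \<Rightarrow> (real^'m) \<times> (real^'k)" where
  "hexp i s = (s *\<^sub>R axis i 1, 0)"

lemma hexp_add:
  assumes "bilinear B" and skew: "\<And>z z'. B z z' = - B z' z"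
  shows "gmul B (hexp i r) (hexp i s) = hexp i (r + s)"
proof -
  have "B z z = 0" for z using skew by (rule skew_diag)
  then show ?thesis using assms(1)
    by (simp add: gmul_def hexp_def bilinear_lmul bilinear_rmul scaleR_add_left)
qed

text \<open>The curve reaches the identity only if x lies on the one-parameter subgroup of
  \<open>e_i\<close>, and there the V2 component vanishes because
  \<open>[e_i, e_i] = 0\<close>.\<close>

lemma gmul_hexp_nonzero:
  assumes "bilinear B" and skew: "\<And>z z'. B z z' = - B z' z" and "snd x \<noteq> 0"
  shows "gmul B (hexp i s) x \<noteq> 0"
proof
  have 0: "B z z = 0" for z using skew by (rule skew_diag)
  assume "gmul B (hexp i s) x = 0"
  then have "s *\<^sub>R axis i 1 + fst x = 0" "snd x + (1/2) *\<^sub>R B (s *\<^sub>R axis i 1) (fst x) = 0"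
    by (simp_all add: gmul_def hexp_def prod_eq_iff)
  moreover from this(1) have "fst x = - s *\<^sub>R axis i 1" by (simp add: add_eq_0_iff)
  ultimately have "snd x = 0"
    using 0 assms(1) by (simp add: bilinear_lmul bilinear_rmul bilinear_rneg)
  with assms(3) show False by simp
qed

lemma continuous_on_hexp: "continuous_on S f \<Longrightarrow> continuous_on S (\<lambda>x. hexp i (f x))"
  unfolding hexp_def by (intro continuous_intros)

text \<open>Substituting \<open>g' = g x\<close> moves the left-invariant derivative from \<open>\<rho>\<close> to the kernel, where
  \<open>X\<^sub>i\<close> becomes the derivative along \<open>s \<mapsto> exp(-s e\<^sub>i) x\<close>.\<close>
definition potential ::
  "(real^'m \<Rightarrow> real^'m \<Rightarrow> real^'k) \<Rightarrow> ((real^'m) \<times> (real^'k) \<Rightarrow> real) \<Rightarrow> ((real^'m) \<times> (real^'k) \<Rightarrow> real)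
    \<Rightarrow> (real^'m) \<times> (real^'k) \<Rightarrow> real" where
  "potential B \<rho> k g = (\<integral>x. \<rho> (gmul B g x) * k x \<partial>lborel)"

text \<open>All such x lie in the image of S x K under the continuous map (s, y) -> c(s)^(-1) y,
  which is compact.\<close>

lemma compact_support_translates:
  assumes B: "bilinear B" and skew: "\<And>z z'. B z z' = - B z' z"
    and K: "compact K" "\<And>x. x \<notin> K \<Longrightarrow> \<rho> x = 0" and S: "compact S" "continuous_on S c"
  obtains R where "\<And>s x. s \<in> S \<Longrightarrow> \<rho> (gmul B (c s) x) \<noteq> 0 \<Longrightarrow> x \<in> cball 0 R"
proof -
  let ?f = "\<lambda>(s, y). gmul B (ginv (c s)) y"
  have "continuous_on (S \<times> K) (\<lambda>x. gmul B (ginv (c (fst x))) (snd x))"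
    unfolding ginv_def
    by (intro continuous_on_gmul[OF B] continuous_intros continuous_on_compose2[OF S(2)]) auto
  then have "compact (?f ` (S \<times> K))"
    by (intro compact_continuous_image compact_Times S K) (simp add: case_prod_beta')
  then obtain R where R: "\<And>y. y \<in> ?f ` (S \<times> K) \<Longrightarrow> norm y \<le> R"
    using compact_imp_bounded bounded_iff by meson
  show ?thesis
  proof
    fix s x assume s: "s \<in> S" "\<rho> (gmul B (c s) x) \<noteq> 0"
    then have "x \<in> ?f ` (S \<times> K)"
      using K(2) gmul_ginv_cancel[OF B skew, of "c s" x]
      by (intro image_eqI[of _ _ "(s, gmul B (c s) x)"]) (simp, blast)
    then show "x \<in> cball 0 R" using R by simp
  qed
qed

section \<open>Differentiating potentials of continuous, compactly supported densities\<close>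

locale compactly_supported_density =
  fixes B :: "real^'m \<Rightarrow> real^'m \<Rightarrow> real^'k"
    and \<rho> :: "(real^'m) \<times> (real^'k) \<Rightarrow> real"
  assumes bilinear: "bilinear B"
    and skew: "B z z' = - B z' z"
    and cont_density: "continuous_on UNIV \<rho>"
    and compact_support: "\<exists>K. compact K \<and> (\<forall>x. x \<notin> K \<longrightarrow> \<rho> x = 0)"
begin

lemma density_bounded: obtains M where "\<And>x. \<bar>\<rho> x\<bar> \<le> M"
proof -
  obtain K where K: "compact K" "\<And>x. x \<notin> K \<Longrightarrow> \<rho> x = 0" using compact_support by blast
  then have "bounded (\<rho> ` K)"
    by (intro compact_imp_bounded compact_continuous_image continuous_on_subset[OF cont_density]) auto
  then obtain M where "\<And>x. x \<in> K \<Longrightarrow> \<bar>\<rho> x\<bar> \<le> M" by (auto simp: bounded_iff)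
  then have "\<bar>\<rho> x\<bar> \<le> max M 0" for x using K(2) by (cases "x \<in> K") fastforce+
  then show ?thesis using that by blast
qed

text \<open>A single majorant for a whole compact curve of translates serves both dominated
  convergence and Fubini.\<close>

lemma density_translate_bound:
  assumes "compact S" "continuous_on S c"
  shows "\<exists>M\<ge>0. \<exists>R. \<forall>s\<in>S. \<forall>x. \<bar>\<rho> (gmul B (c s) x)\<bar> \<le> M * indicator (cball 0 R) x"
proof -
  obtain K where K: "compact K" "\<And>x. x \<notin> K \<Longrightarrow> \<rho> x = 0" using compact_support by blast
  obtain R where R: "\<And>s x. s \<in> S \<Longrightarrow> \<rho> (gmul B (c s) x) \<noteq> 0 \<Longrightarrow> x \<in> cball 0 R"
    using compact_support_translates[of B K \<rho> S c, OF bilinear skew K assms] by blast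
  obtain M where M: "\<And>x. \<bar>\<rho> x\<bar> \<le> M" using density_bounded by blast
  have "0 \<le> M" using M[of 0] by linarith
  moreover have "\<bar>\<rho> (gmul B (c s) x)\<bar> \<le> M * indicator (cball 0 R) x" if "s \<in> S" for s x
    using R[OF that, of x] M[of "gmul B (c s) x"] by (cases "x \<in> cball 0 R") auto
  ultimately show ?thesis by blast
qed

lemma borel_measurable_density [measurable]: "\<rho> \<in> borel_measurable borel"
  using cont_density by (rule borel_measurable_continuous_onI)

lemma borel_measurable_gmul' [measurable (raw)]:
  "f \<in> borel_measurable M \<Longrightarrow> h \<in> borel_measurable M \<Longrightarrow> (\<lambda>x. gmul B (f x) (h x)) \<in> borel_measurable M"
  by (rule borel_measurable_gmul[OF bilinear])

lemma potential_integrable: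
  assumes k: "loc_integrable k"
  shows "integrable lborel (\<lambda>x. \<rho> (gmul B g x) * k x)"
proof -
  have [measurable]: "k \<in> borel_measurable borel" using k by (simp add: loc_integrable_def)
  \<comment> \<open>A single translate is a constant curve over a one-point parameter set.\<close>
  obtain M R where M: "\<And>x. \<bar>\<rho> (gmul B g x)\<bar> \<le> M * indicator (cball 0 R) x" and "0 \<le> M"
    using density_translate_bound[of "{0::real}" "\<lambda>_. g", OF compact_sing continuous_on_const] by auto
  show ?thesis
  proof (rule Bochner_Integration.integrable_bound)
    show "integrable lborel (\<lambda>x. M * \<bar>indicator (cball 0 R) x * k x\<bar>)"
      using k by (auto simp: loc_integrable_def)
    show "AE x in lborel. norm (\<rho> (gmul B g x) * k x) \<le> norm (M * \<bar>indicator (cball 0 R) x * k x\<bar>)"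
    proof (intro AE_I2)
      fix x
      have "\<bar>\<rho> (gmul B g x)\<bar> * \<bar>k x\<bar> \<le> (M * indicator (cball 0 R) x) * \<bar>k x\<bar>"
        by (intro mult_right_mono M) auto
      then show "norm (\<rho> (gmul B g x) * k x) \<le> norm (M * \<bar>indicator (cball 0 R) x * k x\<bar>)"
        using \<open>0 \<le> M\<close> by (simp add: abs_mult)
    qed
  qed measurable
qed

text \<open>Only the density factor depends on s, and it does so continuously. The singular kernel
  stays fixed, so dominated convergence applies.\<close>

lemma continuous_on_potential:
  fixes c :: "real \<Rightarrow> (real^'m) \<times> (real^'k)"
  assumes k: "loc_integrable k" and S: "compact S" "continuous_on S c"
  shows "continuous_on S (\<lambda>s. potential B \<rho> k (c s))"
  unfolding continuous_on_sequentially o_def potential_def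
proof (intro allI ballI impI, elim conjE)
  fix u a assume a: "a \<in> S" "\<forall>n. u n \<in> S" "u \<longlonglongrightarrow> a"
  have [measurable]: "k \<in> borel_measurable borel" using k by (simp add: loc_integrable_def)
  obtain M R where M: "\<And>s x. s \<in> S \<Longrightarrow> \<bar>\<rho> (gmul B (c s) x)\<bar> \<le> M * indicator (cball 0 R) x" and "0 \<le> M"
    using density_translate_bound[OF S] by metis
  show "(\<lambda>n. \<integral>x. \<rho> (gmul B (c (u n)) x) * k x \<partial>lborel) \<longlonglongrightarrow> (\<integral>x. \<rho> (gmul B (c a) x) * k x \<partial>lborel)"
  proof (rule integral_dominated_convergence)
    show "integrable lborel (\<lambda>x. M * \<bar>indicator (cball 0 R) x * k x\<bar>)"
      using k by (auto simp: loc_integrable_def)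
    show "AE x in lborel. (\<lambda>n. \<rho> (gmul B (c (u n)) x) * k x) \<longlonglongrightarrow> \<rho> (gmul B (c a) x) * k x"
    proof (intro AE_I2 tendsto_mult tendsto_const)
      fix x
      have "continuous_on S (\<lambda>s. \<rho> (gmul B (c s) x))"
        by (intro continuous_on_compose2[OF cont_density] continuous_on_gmul[OF bilinear] S continuous_on_const) simp
      then show "(\<lambda>n. \<rho> (gmul B (c (u n)) x)) \<longlonglongrightarrow> \<rho> (gmul B (c a) x)"
        using a unfolding continuous_on_sequentially o_def by blast
    qed
    show "AE x in lborel. norm (\<rho> (gmul B (c (u n)) x) * k x) \<le> M * \<bar>indicator (cball 0 R) x * k x\<bar>" for n
    proof (intro AE_I2)
      fix x
      have "\<bar>\<rho> (gmul B (c (u n)) x)\<bar> * \<bar>k x\<bar> \<le> (M * indicator (cball 0 R) x) * \<bar>k x\<bar>"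
        by (intro mult_right_mono M) (use a in auto)
      then show "norm (\<rho> (gmul B (c (u n)) x) * k x) \<le> M * \<bar>indicator (cball 0 R) x * k x\<bar>"
        using \<open>0 \<le> M\<close> by (simp add: abs_mult)
    qed
  qed measurable
qed

lemma gmul_hexp_cancel: "gmul B (gmul B g (hexp i s)) (gmul B (hexp i (- s)) x) = gmul B g x"
proof -
  have "gmul B (hexp i s) (gmul B (hexp i (- s)) x) = gmul B (hexp i 0) x"
    using hexp_add[OF bilinear skew, of i s "- s"] by (simp flip: gmul_assoc[OF bilinear])
  also have "hexp i 0 = (0 :: (real^'m) \<times> (real^'k))"
    by (simp add: hexp_def zero_prod_def)
  also have "gmul B 0 x = x"
    by (rule gmul_0_left[OF bilinear])
  finally have "gmul B (hexp i s) (gmul B (hexp i (- s)) x) = x" .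
  then show ?thesis by (simp add: gmul_assoc[OF bilinear])
qed

text \<open>Left invariance of Lebesgue measure shifts the displacement from the density, which is
  only continuous, to the kernel.\<close>

lemma potential_translate:
  assumes [measurable]: "k \<in> borel_measurable borel"
  shows "potential B \<rho> k (gmul B g (hexp i s)) = (\<integral>x. \<rho> (gmul B g x) * k (gmul B (hexp i (- s)) x) \<partial>lborel)"
proof -
  have "potential B \<rho> k (gmul B g (hexp i s))
      = (\<integral>x. \<rho> (gmul B (gmul B g (hexp i s)) (gmul B (hexp i (- s)) x)) * k (gmul B (hexp i (- s)) x) \<partial>lborel)"
    unfolding potential_def by (rule integral_gmul[OF bilinear, symmetric]) measurable
  then show ?thesis by (simp add: gmul_hexp_cancel)
qed

lemma integral_along_hexp:
  assumes cont: "continuous_on (- {0}) k'"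
    and der: "\<And>x. x \<noteq> 0 \<Longrightarrow> ((\<lambda>s. k (gmul B (hexp i (- s)) x)) has_real_derivative k' x) (at 0)"
    and x: "snd x \<noteq> 0" and "a \<le> b"
  shows "(\<integral>r. indicator {a..b} r * k' (gmul B (hexp i (- r)) x) \<partial>lborel)
    = k (gmul B (hexp i (- b)) x) - k (gmul B (hexp i (- a)) x)"
proof -
  \<comment> \<open>The hypothesis gives the derivative at parameter 0 only. By the one-parameter
    group law, the curve restarted at its point of parameter r is a shift of the same curve, so the
    derivative is known at every r.\<close>
  have d: "((\<lambda>s. k (gmul B (hexp i (- s)) x)) has_real_derivative k' (gmul B (hexp i (- r)) x)) (at r)" for r
  proof -
    have "((\<lambda>s. k (gmul B (hexp i (- s)) (gmul B (hexp i (- r)) x))) has_real_derivative k' (gmul B (hexp i (- r)) x)) (at 0)"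
      by (rule der) (rule gmul_hexp_nonzero[OF bilinear skew x])
    moreover have "gmul B (hexp i (- s)) (gmul B (hexp i (- r)) x) = gmul B (hexp i (- (s + r))) x" for s
      by (simp add: hexp_add[OF bilinear skew] add.commute flip: gmul_assoc[OF bilinear])
    ultimately show ?thesis
      using DERIV_shift[of "\<lambda>s. k (gmul B (hexp i (- s)) x)" _ 0 r] by simp
  qed
  have c: "continuous_on {a..b} (\<lambda>r. gmul B (hexp i (- r)) x)"
    by (intro continuous_on_gmul[OF bilinear] continuous_on_hexp continuous_on_minus continuous_on_id continuous_on_const)
  have "continuous_on {a..b} (\<lambda>r. k' (gmul B (hexp i (- r)) x))"
    by (rule continuous_on_compose2[OF cont c]) (use gmul_hexp_nonzero[OF bilinear skew x] in \<open>force simp: eq_commute[of 0]\<close>)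
  from integral_FTC_atLeastAtMost[OF \<open>a \<le> b\<close> _ this, of "\<lambda>s. k (gmul B (hexp i (- s)) x)"]
  show ?thesis
    using d by (simp add: has_real_derivative_iff_has_vector_derivative has_vector_derivative_at_within)
qed

text \<open>A curve \<open>s \<mapsto> exp(-s e\<^sub>i) x\<close> can meet the singularity of the kernel only if \<open>x\<close> has no
  component in \<open>V\<^sub>2\<close>.\<close>
lemma AE_snd_nonzero: "AE x::(real^'m) \<times> (real^'k) in lborel. snd x \<noteq> 0"
proof -
  have b: "((0::real^'m), axis undefined 1 :: real^'k) \<in> Basis"
    by (auto simp: Basis_prod_def)
  show ?thesis
    using AE_lborel_coordinates_nonzero
  proof eventually_elim
    fix x :: "(real^'m) \<times> (real^'k)" assume "\<forall>b\<in>Basis. x \<bullet> b \<noteq> 0"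
    with b have "x \<bullet> (0, axis undefined 1) \<noteq> 0" by blast
    then show "snd x \<noteq> 0" by (auto simp: inner_prod_def)
  qed
qed

text \<open>For almost every x the horizontal line through x avoids the singularity, and the
  fundamental theorem of calculus applies to the translated kernel. Fubini then exchanges the
  integral along the line with the one over the group.\<close>

lemma potential_increment:
  assumes k: "loc_integrable k" "loc_integrable k'"
    and cont: "continuous_on (- {0}) k'"
    and der: "\<And>x. x \<noteq> 0 \<Longrightarrow> ((\<lambda>s. k (gmul B (hexp i (- s)) x)) has_real_derivative k' x) (at 0)"
    and "a \<le> b"
  shows "potential B \<rho> k (gmul B g (hexp i b)) - potential B \<rho> k (gmul B g (hexp i a))
    = (\<integral>r. indicator {a..b} r * potential B \<rho> k' (gmul B g (hexp i r)) \<partial>lborel)"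
proof -
  have m[measurable]: "k \<in> borel_measurable borel" "k' \<in> borel_measurable borel"
    using k by (auto simp: loc_integrable_def)
  have [measurable]: "(hexp i :: real \<Rightarrow> (real^'m) \<times> (real^'k)) \<in> borel_measurable borel"
    by (intro borel_measurable_continuous_onI continuous_on_hexp continuous_on_id)
  define c where "c = (\<lambda>r. gmul B g (hexp i r))"
  have c: "continuous_on {a..b} c"
    unfolding c_def by (intro continuous_on_gmul[OF bilinear] continuous_on_hexp continuous_on_id continuous_on_const)
  obtain M R where M: "\<And>s x. s \<in> {a..b} \<Longrightarrow> \<bar>\<rho> (gmul B (c s) x)\<bar> \<le> M * indicator (cball 0 R) x" and "0 \<le> M"
    using density_translate_bound[OF compact_Icc c] by metis
  define H where "H = (\<lambda>r x. indicator {a..b} r * (\<rho> (gmul B g x) * k' (gmul B (hexp i (- r)) x)))"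
  have H': "H r x = \<rho> (gmul B g x) * (indicator {a..b} r * k' (gmul B (hexp i (- r)) x))" for r x
    by (simp add: H_def)
  have Hm: "case_prod H \<in> borel_measurable (lborel \<Otimes>\<^sub>M lborel)"
    unfolding H_def by measurable
  have int_tr: "integrable lborel (\<lambda>x. \<rho> (gmul B g x) * h (gmul B (hexp i (- r)) x))"
    if h: "loc_integrable h" for h r
  proof -
    have [measurable]: "h \<in> borel_measurable borel" using h by (simp add: loc_integrable_def)
    have "(\<lambda>x. \<rho> (gmul B (gmul B g (hexp i r)) x) * h x) \<in> borel_measurable borel"
      by measurable
    from integrable_gmul_iff[OF bilinear this, of "hexp i (- r)"] potential_integrable[OF h, of "gmul B g (hexp i r)"]
    show ?thesis by (simp add: gmul_hexp_cancel)
  qed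
  \<comment> \<open>Translating back to the density makes the L1 norm of each slice comparable to
    one fixed integral, independently of r. This is the absolute integrability that Fubini asks
    for.\<close>
  have norm_le: "(\<integral>x. norm (H r x) \<partial>lborel) \<le> indicator {a..b} r * (\<integral>x. M * \<bar>indicator (cball 0 R) x * k' x\<bar> \<partial>lborel)" for r
  proof (cases "r \<in> {a..b}")
    case True
    have "(\<lambda>x. \<bar>\<rho> (gmul B (c r) x) * k' x\<bar>) \<in> borel_measurable borel"
      by measurable
    from integral_gmul[OF bilinear this, of "hexp i (- r)"]
    have "(\<integral>x. norm (H r x) \<partial>lborel) = (\<integral>x. \<bar>\<rho> (gmul B (c r) x) * k' x\<bar> \<partial>lborel)"
      using True by (simp add: H_def c_def gmul_hexp_cancel)
    also have "\<dots> \<le> (\<integral>x. M * \<bar>indicator (cball 0 R) x * k' x\<bar> \<partial>lborel)"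
    proof (rule integral_mono)
      show "integrable lborel (\<lambda>x. \<bar>\<rho> (gmul B (c r) x) * k' x\<bar>)"
        by (intro integrable_abs potential_integrable k)
      show "integrable lborel (\<lambda>x. M * \<bar>indicator (cball 0 R) x * k' x\<bar>)"
        using k by (auto simp: loc_integrable_def)
      show "\<bar>\<rho> (gmul B (c r) x) * k' x\<bar> \<le> M * \<bar>indicator (cball 0 R) x * k' x\<bar>" for x
        using mult_right_mono[OF M[OF True, of x] abs_ge_zero[of "k' x"]] by (simp add: abs_mult mult.assoc)
    qed
    finally show ?thesis using True by simp
  qed (simp add: H_def)
  have "integrable (lborel \<Otimes>\<^sub>M lborel) (case_prod H)"
  proof (rule lborel_pair.Fubini_integrable)
    show "AE r in lborel. integrable lborel (\<lambda>x. case_prod H (r, x))"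
      using int_tr[OF k(2)] by (auto simp: H_def)
    show "integrable lborel (\<lambda>r. \<integral>x. norm (case_prod H (r, x)) \<partial>lborel)"
    proof (rule Bochner_Integration.integrable_bound)
      show "integrable lborel (\<lambda>r. indicator {a..b} r * (\<integral>x. M * \<bar>indicator (cball 0 R) x * k' x\<bar> \<partial>lborel))"
        by (intro integrable_mult_left integrable_real_indicator) (use \<open>a \<le> b\<close> in auto)
      have "(\<lambda>(r, x). norm (H r x)) \<in> borel_measurable (lborel \<Otimes>\<^sub>M lborel)"
        unfolding H_def by measurable
      then show "(\<lambda>r. \<integral>x. norm (case_prod H (r, x)) \<partial>lborel) \<in> borel_measurable lborel"
        by (subst case_prod_conv) (rule lborel.borel_measurable_lebesgue_integral)
      show "AE r in lborel. norm (\<integral>x. norm (case_prod H (r, x)) \<partial>lborel)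
          \<le> norm (indicator {a..b} r * (\<integral>x. M * \<bar>indicator (cball 0 R) x * k' x\<bar> \<partial>lborel))"
      proof (intro AE_I2)
        fix r
        have "0 \<le> (\<integral>x. norm (H r x) \<partial>lborel)" by simp
        with norm_le[of r] show "norm (\<integral>x. norm (case_prod H (r, x)) \<partial>lborel)
            \<le> norm (indicator {a..b} r * (\<integral>x. M * \<bar>indicator (cball 0 R) x * k' x\<bar> \<partial>lborel))"
          unfolding case_prod_conv real_norm_def by linarith
      qed
    qed
  qed fact
  then have Fub: "(\<integral>x. (\<integral>r. H r x \<partial>lborel) \<partial>lborel) = (\<integral>r. (\<integral>x. H r x \<partial>lborel) \<partial>lborel)"
    by (rule lborel_pair.Fubini_integral)
  have 1: "(\<integral>r. (\<integral>x. H r x \<partial>lborel) \<partial>lborel) = (\<integral>r. indicator {a..b} r * potential B \<rho> k' (gmul B g (hexp i r)) \<partial>lborel)"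
    by (simp add: H_def potential_translate)
  have 2: "(\<integral>x. (\<integral>r. H r x \<partial>lborel) \<partial>lborel)
     = (\<integral>x. \<rho> (gmul B g x) * k (gmul B (hexp i (- b)) x) - \<rho> (gmul B g x) * k (gmul B (hexp i (- a)) x) \<partial>lborel)"
  proof (rule integral_cong_AE)
    show "AE x in lborel. (\<integral>r. H r x \<partial>lborel)
       = \<rho> (gmul B g x) * k (gmul B (hexp i (- b)) x) - \<rho> (gmul B g x) * k (gmul B (hexp i (- a)) x)"
      using AE_snd_nonzero
    proof eventually_elim
      fix x :: "(real^'m) \<times> (real^'k)" assume "snd x \<noteq> 0"
      from integral_along_hexp[OF cont der this \<open>a \<le> b\<close>]
      show "(\<integral>r. H r x \<partial>lborel)
       = \<rho> (gmul B g x) * k (gmul B (hexp i (- b)) x) - \<rho> (gmul B g x) * k (gmul B (hexp i (- a)) x)"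
        by (simp add: H' right_diff_distrib)
    qed
    have "(\<lambda>(x, r). H r x) \<in> borel_measurable (lborel \<Otimes>\<^sub>M lborel)"
      unfolding H_def by measurable
    then show "(\<lambda>x. \<integral>r. H r x \<partial>lborel) \<in> borel_measurable lborel"
      by (rule lborel.borel_measurable_lebesgue_integral)
  qed measurable
  have 3: "\<dots> = potential B \<rho> k (gmul B g (hexp i b)) - potential B \<rho> k (gmul B g (hexp i a))"
    by (simp add: potential_translate Bochner_Integration.integral_diff int_tr k)
  show ?thesis by (simp only: 1[symmetric] Fub[symmetric] 2 3)
qed

lemma has_real_derivative_potential:
  assumes k: "loc_integrable k" "loc_integrable k'"
    and cont: "continuous_on (- {0}) k'"
    and der: "\<And>x. x \<noteq> 0 \<Longrightarrow> ((\<lambda>s. k (gmul B (hexp i (- s)) x)) has_real_derivative k' x) (at 0)"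
  shows "((\<lambda>s. potential B \<rho> k (gmul B g (hexp i s))) has_real_derivative potential B \<rho> k' g) (at 0)"
proof -
  define G where "G = (\<lambda>r. potential B \<rho> k' (gmul B g (hexp i r)))"
  have cG: "continuous_on {-1..1} G"
    unfolding G_def by (intro continuous_on_potential k compact_Icc continuous_on_gmul[OF bilinear] continuous_on_hexp continuous_on_id continuous_on_const)
  \<comment> \<open>The increment formula needs ordered endpoints. The base point -1 puts 0 in the
    interior, so one indefinite integral of the continuous \<open>G\<close> describes the potential
    on both sides of 0.\<close>
  have eq: "potential B \<rho> k (gmul B g (hexp i s)) = potential B \<rho> k (gmul B g (hexp i (-1))) + integral {-1..s} G"
    if "s \<in> {-1..1}" for s
  proof -
    have "set_integrable lborel {-1..s} G"
      using cG that by (intro borel_integrable_atLeastAtMost' continuous_on_subset[OF cG]) auto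
    from set_borel_integral_eq_integral(2)[OF this]
    show ?thesis
      using potential_increment[OF k cont der, of "-1" s g] that
      by (simp add: set_lebesgue_integral_def G_def)
  qed
  have "G 0 = potential B \<rho> k' g"
    using bilinear_rzero[OF bilinear] by (simp add: G_def gmul_def hexp_def)
  moreover have "((\<lambda>s. potential B \<rho> k (gmul B g (hexp i (-1))) + integral {-1..s} G) has_real_derivative 0 + G 0) (at 0 within {-1..1})"
    by (intro derivative_intros integral_has_real_derivative cG) auto
  ultimately have d: "((\<lambda>s. potential B \<rho> k (gmul B g (hexp i (-1))) + integral {-1..s} G) has_real_derivative potential B \<rho> k' g) (at 0 within {-1..1})"
    by simp
  have "((\<lambda>s. potential B \<rho> k (gmul B g (hexp i s))) has_real_derivative potential B \<rho> k' g) (at 0 within {-1..1})"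
    by (rule has_field_derivative_transform_within[OF d zero_less_one]) (simp, rule eq[symmetric])
  then show ?thesis
    by (simp add: at_within_Icc_at)
qed

end

section \<open>The gauge on groups of Heisenberg type\<close>

text \<open>The fourth power of the gauge is a polynomial and so can be differentiated even at the
  identity. Powers of the gauge become powers of it with a quarter of the exponent.\<close>

definition gauge4 :: "(real^'m) \<times> (real^'k) \<Rightarrow> real" where
  "gauge4 x = norm (fst x) ^ 4 + 16 * norm (snd x) ^ 2"

text \<open>First and second derivatives of \<open>gauge4\<close> along the curves \<open>s \<mapsto> exp(-s e\<^sub>i) x\<close>, which are
  integral curves of the right-invariant, not of the left-invariant, fields.\<close>
definition grad_gauge4 :: "(real^'m \<Rightarrow> real^'m \<Rightarrow> real^'k) \<Rightarrow> 'm \<Rightarrow> (real^'m) \<times> (real^'k) \<Rightarrow> real" where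
  "grad_gauge4 B i x = - 4 * norm (fst x) ^ 2 * fst x $ i + 16 * (B (fst x) (axis i 1) \<bullet> snd x)"

definition hess_gauge4 :: "(real^'m \<Rightarrow> real^'m \<Rightarrow> real^'k) \<Rightarrow> 'm \<Rightarrow> 'm \<Rightarrow> (real^'m) \<times> (real^'k) \<Rightarrow> real" where
  "hess_gauge4 B i j x = 8 * fst x $ i * fst x $ j + 4 * norm (fst x) ^ 2 * (if i = j then 1 else 0)
     + 8 * (B (fst x) (axis i 1) \<bullet> B (fst x) (axis j 1)) - 16 * (B (axis j 1) (axis i 1) \<bullet> snd x)"

lemma gauge4_nonneg: "0 \<le> gauge4 x"
  by (simp add: gauge4_def)

lemma gauge4_pos: "x \<noteq> 0 \<Longrightarrow> 0 < gauge4 x"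
  by (auto simp: gauge4_def prod_eq_iff add_nonneg_pos add_pos_nonneg)

lemma gauge_powr: "gauge x powr a = gauge4 x powr (a / 4)"
  by (simp add: gauge_def gauge4_def powr_powr)

lemma ln_gauge: "ln (gauge x) = ln (gauge4 x) / 4"
  by (simp add: gauge_def gauge4_def ln_powr)

lemma gmul_hexp_uminus:
  assumes "bilinear B" and skew: "\<And>z z'. B z z' = - B z' z"
  shows "gmul B (hexp i (- s)) x = (fst x - s *\<^sub>R axis i 1, snd x + (s / 2) *\<^sub>R B (fst x) (axis i 1))"
  using assms(1) skew[of "axis i 1" "fst x"]
  by (simp add: gmul_def hexp_def bilinear_lneg bilinear_lmul)

lemma norm_diff_axis_sq:
  fixes z :: "real^'m"
  shows "norm (z - s *\<^sub>R axis i 1) ^ 2 = norm z ^ 2 - 2 * s * z $ i + s ^ 2"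
  unfolding power2_norm_eq_inner
  by (simp add: inner_diff_left inner_diff_right inner_commute[of "axis i 1"] inner_axis inner_axis_axis power2_eq_square algebra_simps)

lemma norm_add_scaleR_sq:
  fixes t b :: "'a::real_inner"
  shows "norm (t + r *\<^sub>R b) ^ 2 = norm t ^ 2 + 2 * r * (b \<bullet> t) + r ^ 2 * (b \<bullet> b)"
  unfolding power2_norm_eq_inner
  by (simp add: inner_add_left inner_add_right inner_commute power2_eq_square algebra_simps)

section \<open>Horizontal derivatives of the gauge and their contractions\<close>

lemma has_derivative_gauge4:
  assumes "bilinear B" and skew: "\<And>z z'. B z z' = - B z' z"
  shows "((\<lambda>s. gauge4 (gmul B (hexp i (- s)) x)) has_real_derivative grad_gauge4 B i x) (at 0)"
proof -
  \<comment> \<open>Along the curve the function is a polynomial in s, whose derivative at 0 is the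
    linear coefficient.\<close>
  have *: "gauge4 (gmul B (hexp i (- s)) x) = (norm (fst x) ^ 2 - 2 * s * fst x $ i + s ^ 2) ^ 2
      + 16 * (norm (snd x) ^ 2 + s * (B (fst x) (axis i 1) \<bullet> snd x) + s ^ 2 / 4 * (B (fst x) (axis i 1) \<bullet> B (fst x) (axis i 1)))" for s
  proof -
    have pow4: "r ^ 4 = (r ^ 2) ^ 2" for r :: real by simp
    show ?thesis
      by (simp only: gauge4_def gmul_hexp_uminus[OF assms] fst_conv snd_conv pow4 norm_diff_axis_sq norm_add_scaleR_sq)
         (simp add: power_divide)
  qed
  show ?thesis
    unfolding * by (rule derivative_eq_intros refl | simp add: grad_gauge4_def)+
qed

lemma has_derivative_grad_gauge4:
  fixes B :: "real^'m \<Rightarrow> real^'m \<Rightarrow> real^'k"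
  assumes "bilinear B" and skew: "\<And>z z'. B z z' = - B z' z"
  shows "((\<lambda>s. grad_gauge4 B j (gmul B (hexp i (- s)) x)) has_real_derivative hess_gauge4 B j i x) (at 0)"
proof -
  let ?b = "\<lambda>i. B (fst x) (axis i 1)"
  have *: "grad_gauge4 B j (gmul B (hexp i (- s)) x)
     = - 4 * (norm (fst x) ^ 2 - 2 * s * fst x $ i + s ^ 2) * (fst x $ j - s * (if i = j then 1 else 0))
      + 16 * (?b j \<bullet> snd x + s / 2 * (?b j \<bullet> ?b i) - s * (B (axis i 1) (axis j 1) \<bullet> snd x)
               - s * (s / 2) * (B (axis i 1) (axis j 1) \<bullet> ?b i))" for s
  proof -
    have ax: "(axis i 1 :: real^'m) $ j = (if i = j then 1 else 0)"
      by (simp add: axis_def)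
    show ?thesis
      using assms(1)
      by (simp add: grad_gauge4_def gmul_hexp_uminus[OF assms] norm_diff_axis_sq bilinear_lsub bilinear_lmul
        inner_diff_left inner_add_right ax algebra_simps)
  qed
  show ?thesis
    unfolding * by (rule derivative_eq_intros refl | simp add: hess_gauge4_def)+
qed

lemma bilinear_expand_right:
  fixes B :: "real^'m \<Rightarrow> real^'m \<Rightarrow> real^'k"
  assumes "bilinear B"
  shows "B z v = (\<Sum>i\<in>UNIV. v $ i *\<^sub>R B z (axis i 1))"
proof -
  have "linear (B z)" using assms by (simp add: bilinear_def)
  then have "B z (\<Sum>i\<in>UNIV. v $ i *\<^sub>R axis i 1) = (\<Sum>i\<in>UNIV. v $ i *\<^sub>R B z (axis i 1))"
    by (simp add: linear_sum linear_cmul)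
  then show ?thesis by (simp add: basis_expansion flip: scalar_mult_eq_scaleR)
qed

lemma sum_inner_bilinear:
  fixes B :: "real^'m \<Rightarrow> real^'m \<Rightarrow> real^'k"
  assumes "bilinear B"
  shows "(\<Sum>i\<in>UNIV. v $ i * (B z (axis i 1) \<bullet> t)) = B z v \<bullet> t"
  by (subst (2) bilinear_expand_right[OF assms]) (simp add: inner_sum_left)

lemma bilinear_expand_left:
  fixes B :: "real^'m \<Rightarrow> real^'m \<Rightarrow> real^'k"
  assumes "bilinear B"
  shows "B v z = (\<Sum>i\<in>UNIV. v $ i *\<^sub>R B (axis i 1) z)"
proof -
  have l: "linear (\<lambda>v. B v z)" using assms by (simp add: bilinear_def)
  have "B (\<Sum>i\<in>UNIV. v $ i *\<^sub>R axis i 1) z = (\<Sum>i\<in>UNIV. v $ i *\<^sub>R B (axis i 1) z)"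
    by (simp only: linear_sum[OF l] linear_cmul[OF l])
  then show ?thesis by (simp add: basis_expansion flip: scalar_mult_eq_scaleR)
qed

lemma norm_sq_sum: "norm (z::real^'m) ^ 2 = (\<Sum>i\<in>UNIV. (z $ i)\<^sup>2)"
  unfolding power2_norm_eq_inner by (simp add: inner_vec_def power2_eq_square)

text \<open>The summed terms are the squared coordinates of J(t)z, and J(t) is |t| times an
  orthogonal map.\<close>

lemma heisenberg_type_sum_sq:
  fixes B :: "real^'m \<Rightarrow> real^'m \<Rightarrow> real^'k"
  assumes "heisenberg_type B"
  shows "(\<Sum>i\<in>UNIV. (B z (axis i 1) \<bullet> t)\<^sup>2) = norm t ^ 2 * norm z ^ 2"
proof (cases "t = 0")
  case False
  define u where "u = (1 / norm t) *\<^sub>R t"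
  have u: "norm u = 1" "t = norm t *\<^sub>R u" using False by (auto simp: u_def)
  from u(1) have "norm (Jmap B u z) = norm z"
    using assms by (auto simp: heisenberg_type_def orthogonal_transformation_norm)
  moreover have "norm (Jmap B u z) ^ 2 = (\<Sum>i\<in>UNIV. (B z (axis i 1) \<bullet> u)\<^sup>2)"
    unfolding norm_sq_sum by (simp add: Jmap_def)
  ultimately have "(\<Sum>i\<in>UNIV. (B z (axis i 1) \<bullet> u)\<^sup>2) = norm z ^ 2" by simp
  moreover have "(B z (axis i 1) \<bullet> t)\<^sup>2 = norm t ^ 2 * (B z (axis i 1) \<bullet> u)\<^sup>2" for i
    by (subst u(2)) (simp add: power_mult_distrib)
  ultimately show ?thesis by (simp flip: sum_distrib_left)
qed simp

text \<open>Each of the k orthonormal directions of V2 contributes |z|^2 by the preceding identity.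
  This is the source of the summand 2k of Q in the trace of the Hessian.\<close>

lemma heisenberg_type_sum_norm_sq:
  fixes B :: "real^'m \<Rightarrow> real^'m \<Rightarrow> real^'k"
  assumes "heisenberg_type B"
  shows "(\<Sum>i\<in>UNIV. norm (B z (axis i 1)) ^ 2) = real CARD('k) * norm z ^ 2"
proof -
  have "(\<Sum>i\<in>UNIV. norm (B z (axis i 1)) ^ 2) = (\<Sum>s\<in>UNIV. \<Sum>i\<in>UNIV. (B z (axis i 1) \<bullet> axis s 1)\<^sup>2)"
    by (subst sum.swap) (simp add: norm_sq_sum inner_axis)
  also have "\<dots> = (\<Sum>s\<in>(UNIV::'k set). norm z ^ 2)"
    by (simp add: heisenberg_type_sum_sq[OF assms])
  finally show ?thesis by simp
qed

lemma heisenberg_typeD: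
  assumes "heisenberg_type B"
  shows "bilinear B" "B z z' = - B z' z"
  using assms unfolding heisenberg_type_def carnot_step2_def by blast+

lemma sum_grad_gauge4:
  assumes "bilinear B"
  shows "(\<Sum>i\<in>UNIV. grad_gauge4 B i x * v $ i)
    = - 4 * norm (fst x) ^ 2 * (fst x \<bullet> v) + 16 * (B (fst x) v \<bullet> snd x)"
proof -
  have "(\<Sum>i\<in>UNIV. grad_gauge4 B i x * v $ i)
    = (\<Sum>i\<in>UNIV. - 4 * norm (fst x) ^ 2 * (fst x $ i * v $ i) + 16 * (v $ i * (B (fst x) (axis i 1) \<bullet> snd x)))"
    by (intro sum.cong) (simp_all add: grad_gauge4_def algebra_simps)
  also have "\<dots> = - 4 * norm (fst x) ^ 2 * (fst x \<bullet> v) + 16 * (\<Sum>i\<in>UNIV. v $ i * (B (fst x) (axis i 1) \<bullet> snd x))"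
    by (simp only: sum.distrib sum_distrib_left[symmetric] inner_vec_def inner_real_def)
  finally show ?thesis
    by (simp only: sum_inner_bilinear[OF assms])
qed

lemma sum_hess_gauge4:
  assumes "bilinear B" and skew: "\<And>z z'. B z z' = - B z' z"
  shows "(\<Sum>i\<in>UNIV. \<Sum>j\<in>UNIV. hess_gauge4 B i j x * v $ i * v $ j)
    = 8 * (fst x \<bullet> v)\<^sup>2 + 4 * norm (fst x) ^ 2 * norm v ^ 2 + 8 * norm (B (fst x) v) ^ 2"
proof -
  \<comment> \<open>This part of the Hessian is antisymmetric and reflects that the fields do not
    commute. A quadratic form does not see it, since B v v = 0.\<close>
  have "(\<Sum>i\<in>UNIV. \<Sum>j\<in>UNIV. (B (axis j 1) (axis i 1) \<bullet> snd x) * v $ i * v $ j) = B v v \<bullet> snd x"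
  proof -
    have "B v v \<bullet> snd x = (\<Sum>i\<in>UNIV. v $ i * (B v (axis i 1) \<bullet> snd x))"
      by (rule sum_inner_bilinear[OF assms(1), symmetric])
    also have "\<dots> = (\<Sum>i\<in>UNIV. \<Sum>j\<in>UNIV. (B (axis j 1) (axis i 1) \<bullet> snd x) * v $ i * v $ j)"
      by (subst bilinear_expand_left[OF assms(1)]) (simp add: inner_sum_left sum_distrib_left mult_ac)
    finally show ?thesis ..
  qed
  moreover have "B v v = 0" using skew by (rule skew_diag)
  moreover have "(\<Sum>i\<in>UNIV. \<Sum>j\<in>UNIV. (B (fst x) (axis i 1) \<bullet> B (fst x) (axis j 1)) * v $ i * v $ j) = norm (B (fst x) v) ^ 2"
    unfolding power2_norm_eq_inner bilinear_expand_right[OF assms(1), of "fst x" v]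
    by (simp add: inner_sum_left inner_sum_right sum_distrib_left inner_commute mult_ac)
  moreover have "(\<Sum>i\<in>UNIV. \<Sum>j\<in>UNIV. fst x $ i * fst x $ j * v $ i * v $ j) = (fst x \<bullet> v)\<^sup>2"
    by (simp add: inner_vec_def power2_eq_square sum_product algebra_simps)
  moreover have "(\<Sum>i\<in>UNIV. \<Sum>j\<in>UNIV. (if i = j then 1 else 0) * v $ i * v $ j) = norm v ^ 2"
    unfolding norm_sq_sum by (simp add: power2_eq_square if_distrib[of "\<lambda>x. x * _"] cong: if_cong)
  moreover have "(\<Sum>i\<in>UNIV. \<Sum>j\<in>UNIV. hess_gauge4 B i j x * v $ i * v $ j)
     = 8 * (\<Sum>i\<in>UNIV. \<Sum>j\<in>UNIV. fst x $ i * fst x $ j * v $ i * v $ j)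
     + 4 * norm (fst x) ^ 2 * (\<Sum>i\<in>UNIV. \<Sum>j\<in>UNIV. (if i = j then 1 else 0) * v $ i * v $ j)
     + 8 * (\<Sum>i\<in>UNIV. \<Sum>j\<in>UNIV. (B (fst x) (axis i 1) \<bullet> B (fst x) (axis j 1)) * v $ i * v $ j)
     - 16 * (\<Sum>i\<in>UNIV. \<Sum>j\<in>UNIV. (B (axis j 1) (axis i 1) \<bullet> snd x) * v $ i * v $ j)"
    unfolding sum_distrib_left sum.distrib[symmetric] sum_subtractf[symmetric] hess_gauge4_def
    by (intro sum.cong refl) (simp add: ring_distribs mult.assoc)
  ultimately show ?thesis by simp
qed

text \<open>The gradient is -4|z|^2 z + 16 J(t)z. The two vectors are orthogonal because [z,z] = 0,
  and |J(t)z| = |t||z|, so the squares add up; the weight 16 in the gauge is what makes the sum a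
  multiple of \<open>gauge4\<close>.\<close>

lemma sum_grad_gauge4_sq:
  fixes B :: "real^'m \<Rightarrow> real^'m \<Rightarrow> real^'k"
  assumes "heisenberg_type B"
  shows "(\<Sum>i\<in>UNIV. (grad_gauge4 B i x)\<^sup>2) = 16 * norm (fst x) ^ 2 * gauge4 x"
proof -
  let ?b = "\<lambda>i. B (fst x) (axis i 1) \<bullet> snd x"
  have 0: "(\<Sum>i\<in>UNIV. fst x $ i * ?b i) = 0"
  proof -
    have "(\<Sum>i\<in>UNIV. fst x $ i * ?b i) = B (fst x) (fst x) \<bullet> snd x"
      by (rule sum_inner_bilinear[OF heisenberg_typeD(1)[OF assms]])
    also have "B (fst x) (fst x) = 0"
      using heisenberg_typeD(2)[OF assms] by (rule skew_diag)
    finally show ?thesis by simp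
  qed
  have "(grad_gauge4 B i x)\<^sup>2 = 16 * norm (fst x) ^ 4 * (fst x $ i)\<^sup>2 - 128 * norm (fst x) ^ 2 * (fst x $ i * ?b i) + 256 * (?b i)\<^sup>2" for i
    by (simp add: grad_gauge4_def power2_eq_square power4_eq_xxxx algebra_simps)
  then have "(\<Sum>i\<in>UNIV. (grad_gauge4 B i x)\<^sup>2)
     = 16 * norm (fst x) ^ 4 * (\<Sum>i\<in>UNIV. (fst x $ i)\<^sup>2) - 128 * norm (fst x) ^ 2 * (\<Sum>i\<in>UNIV. fst x $ i * ?b i) + 256 * (\<Sum>i\<in>UNIV. (?b i)\<^sup>2)"
    by (simp add: sum.distrib sum_subtractf sum_distrib_left)
  then show ?thesis
    unfolding 0 heisenberg_type_sum_sq[OF assms]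
    unfolding gauge4_def norm_sq_sum[symmetric] by (simp add: algebra_simps)
qed

lemma sum_hess_gauge4_diag:
  fixes B :: "real^'m \<Rightarrow> real^'m \<Rightarrow> real^'k"
  assumes "heisenberg_type B"
  shows "(\<Sum>i\<in>UNIV. hess_gauge4 B i i x) = 4 * norm (fst x) ^ 2 * (hom_dim B + 2)"
proof -
  have "B z z = 0" for z
    using heisenberg_typeD(2)[OF assms] by (rule skew_diag)
  then have "(\<Sum>i\<in>UNIV. hess_gauge4 B i i x)
    = 8 * (\<Sum>i\<in>UNIV. (fst x $ i)\<^sup>2) + (\<Sum>i\<in>(UNIV::'m set). 4 * norm (fst x) ^ 2) + 8 * (\<Sum>i\<in>UNIV. norm (B (fst x) (axis i 1)) ^ 2)"
    by (simp add: hess_gauge4_def sum.distrib sum_distrib_left power2_eq_square mult.assoc flip: power2_norm_eq_inner)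
  then show ?thesis
    by (simp add: heisenberg_type_sum_norm_sq[OF assms] hom_dim_def algebra_simps flip: norm_sq_sum)
qed

text \<open>Cauchy--Schwarz for the pairs \<open>(|z|\<^sup>2, 4|t|)\<close> and \<open>(\<langle>z,v\<rangle>, |[z,v]|)\<close>.\<close>
lemma grad_gauge4_direction_bound:
  assumes "bilinear B"
  shows "(\<Sum>i\<in>UNIV. grad_gauge4 B i x * v $ i)\<^sup>2 \<le> 16 * gauge4 x * ((fst x \<bullet> v)\<^sup>2 + norm (B (fst x) v) ^ 2)"
proof -
  let ?z = "norm (fst x) ^ 2" and ?a = "fst x \<bullet> v" and ?b = "norm (B (fst x) v)" and ?t = "norm (snd x)"
  have "\<bar>B (fst x) v \<bullet> snd x\<bar> \<le> ?b * ?t" by (rule Cauchy_Schwarz_ineq2)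
  moreover have "\<bar>- 4 * ?z * ?a + 16 * (B (fst x) v \<bullet> snd x)\<bar> \<le> \<bar>- 4 * ?z * ?a\<bar> + \<bar>16 * (B (fst x) v \<bullet> snd x)\<bar>"
    by (rule abs_triangle_ineq)
  moreover have "\<bar>- 4 * ?z * ?a\<bar> = 4 * (?z * \<bar>?a\<bar>)" "\<bar>16 * (B (fst x) v \<bullet> snd x)\<bar> = 16 * \<bar>B (fst x) v \<bullet> snd x\<bar>"
    by (simp_all add: abs_mult)
  moreover have "4 * (?z * \<bar>?a\<bar> + 4 * ?t * ?b) = 4 * (?z * \<bar>?a\<bar>) + 16 * (?b * ?t)"
    by (simp add: algebra_simps)
  ultimately have "\<bar>\<Sum>i\<in>UNIV. grad_gauge4 B i x * v $ i\<bar> \<le> 4 * (?z * \<bar>?a\<bar> + 4 * ?t * ?b)"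
    unfolding sum_grad_gauge4[OF assms] by linarith
  from power_mono[OF this abs_ge_zero, of 2]
  have "(\<Sum>i\<in>UNIV. grad_gauge4 B i x * v $ i)\<^sup>2 \<le> (4 * (?z * \<bar>?a\<bar> + 4 * ?t * ?b))\<^sup>2"
    by (simp only: power2_abs)
  also have "\<dots> = 16 * (?z * \<bar>?a\<bar> + 4 * ?t * ?b)\<^sup>2" by (simp only: power_mult_distrib) simp
  \<comment> \<open>Lagrange's identity: the two sides differ by 16 times the square of
    \<open>?z * ?b - 4 * ?t * \<bar>?a\<bar>\<close>.\<close>
  also have "\<dots> \<le> 16 * ((?z\<^sup>2 + (4 * ?t)\<^sup>2) * (\<bar>?a\<bar>\<^sup>2 + ?b\<^sup>2))"
    using zero_le_power2[of "?z * ?b - 4 * ?t * \<bar>?a\<bar>"]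
    by (simp add: power2_eq_square algebra_simps)
  also have "\<dots> = 16 * gauge4 x * (?a\<^sup>2 + ?b\<^sup>2)"
    by (simp add: gauge4_def power_mult_distrib)
  finally show ?thesis .
qed

section \<open>Size bounds and local integrability of gauge powers\<close>

lemma continuous_on_gauge4: "continuous_on S gauge4"
  unfolding gauge4_def by (intro continuous_intros)

lemma borel_measurable_gauge4 [measurable]: "gauge4 \<in> borel_measurable borel"
  by (intro borel_measurable_continuous_onI continuous_on_gauge4)

lemma norm_fst_sq_le_gauge4: "norm (fst x) ^ 2 \<le> gauge4 x powr (1/2)"
proof -
  have "(norm (fst x) ^ 2) ^ 2 \<le> gauge4 x" by (simp add: gauge4_def)
  from real_le_rsqrt[OF this] show ?thesis by (simp add: powr_half_sqrt gauge4_nonneg)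
qed

lemma norm_snd_le_gauge4: "norm (snd x) \<le> gauge4 x powr (1/2)"
proof -
  have "norm (snd x) ^ 2 \<le> gauge4 x" by (simp add: gauge4_def)
  from real_le_rsqrt[OF this] show ?thesis by (simp add: powr_half_sqrt gauge4_nonneg)
qed

lemma norm_fst_le_gauge4: "norm (fst x) \<le> gauge4 x powr (1/4)"
proof (rule power2_le_imp_le)
  have "(gauge4 x powr (1/4)) ^ 2 = gauge4 x powr (1/2)"
    by (simp add: power2_eq_square flip: powr_add)
  then show "norm (fst x) ^ 2 \<le> (gauge4 x powr (1/4)) ^ 2"
    using norm_fst_sq_le_gauge4[of x] by simp
qed simp

text \<open>Since the gauge to the power \<open>Q\<close> dominates the product of all coordinates, integrability of
  \<open>N\<^sup>-\<^sup>\<gamma>\<close> for \<open>\<gamma> < Q\<close> reduces to one variable.\<close>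
lemma prod_coordinates_le_gauge4:
  fixes x :: "(real^'m) \<times> (real^'k)"
  assumes "x \<noteq> 0"
  shows "(\<Prod>i\<in>Basis. \<bar>x \<bullet> i\<bar>) \<le> gauge4 x powr ((CARD('m) + 2 * CARD('k)) / 4)"
proof -
  have w: "0 < gauge4 x" by (rule gauge4_pos[OF assms])
  have B: "(Basis :: ((real^'m) \<times> (real^'k)) set) = (\<lambda>u. (u, 0)) ` Basis \<union> (\<lambda>v. (0, v)) ` Basis"
    by (simp add: Basis_prod_def)
  have "(\<Prod>i\<in>Basis. \<bar>x \<bullet> i\<bar>) = (\<Prod>i\<in>(\<lambda>u. (u, 0)) ` Basis. \<bar>x \<bullet> i\<bar>) * (\<Prod>i\<in>(\<lambda>v. (0, v)) ` Basis. \<bar>x \<bullet> i\<bar>)"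
    unfolding B by (rule prod.union_disjoint) auto
  also have "\<dots> = (\<Prod>i\<in>Basis. \<bar>fst x \<bullet> i\<bar>) * (\<Prod>i\<in>Basis. \<bar>snd x \<bullet> i\<bar>)"
    by (subst (1 2) prod.reindex) (auto simp: inj_on_def inner_prod_def)
  also have "\<dots> \<le> (\<Prod>i\<in>(Basis :: (real^'m) set). gauge4 x powr (1/4)) * (\<Prod>i\<in>(Basis :: (real^'k) set). gauge4 x powr (1/2))"
  proof (intro mult_mono prod_mono conjI prod_nonneg)
    show "\<bar>fst x \<bullet> i\<bar> \<le> gauge4 x powr (1/4)" if "i \<in> Basis" for i
      using Basis_le_norm[OF that, of "fst x"] norm_fst_le_gauge4[of x] by linarith
    show "\<bar>snd x \<bullet> i\<bar> \<le> gauge4 x powr (1/2)" if "i \<in> Basis" for i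
      using Basis_le_norm[OF that, of "snd x"] norm_snd_le_gauge4[of x] by linarith
  qed auto
  also have "\<dots> = (gauge4 x powr (1/4)) powr CARD('m) * (gauge4 x powr (1/2)) powr CARD('k)"
    using w by (simp add: powr_realpow)
  also have "\<dots> = gauge4 x powr ((CARD('m) + 2 * CARD('k)) / 4)"
    by (simp add: powr_powr add_divide_distrib flip: powr_add)
  finally show ?thesis .
qed

lemma loc_integrable_gauge4_powr:
  fixes d :: real
  assumes d: "- (real (CARD('m) + 2 * CARD('k)) / 4) < d"
  shows "loc_integrable (\<lambda>x::(real^'m) \<times> (real^'k). gauge4 x powr d)"
proof (cases "d < 0")
  case True
  define Q where "Q = real (CARD('m) + 2 * CARD('k))"
  have Q: "0 < Q" unfolding Q_def using zero_less_card_finite[where 'a='m] by linarith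
  have dQ: "- (Q / 4) < d" using d unfolding Q_def .
  \<comment> \<open>This choice makes w^d = (w^(Q/4))^(-b) for w = \<open>gauge4 x\<close>, and d >
    -Q/4 is precisely b < 1, the one-variable condition.\<close>
  define b where "b = - 4 * d / Q"
  have b: "0 < b" "b < 1" using True dQ Q by (simp_all add: b_def field_simps)
  have m: "(\<lambda>x::(real^'m) \<times> (real^'k). gauge4 x powr d) \<in> borel_measurable borel" by measurable
  show ?thesis
  proof (rule loc_integrable_bound[OF loc_integrable_product_powr[OF b(2)] m, where C=1])
    show "AE x::(real^'m) \<times> (real^'k) in lborel. \<bar>gauge4 x powr d\<bar> \<le> 1 * (\<Prod>i\<in>Basis. \<bar>x \<bullet> i\<bar> powr - b)"
      using AE_lborel_coordinates_nonzero
    proof eventually_elim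
      fix x :: "(real^'m) \<times> (real^'k)"
      assume x: "\<forall>i\<in>Basis. x \<bullet> i \<noteq> 0"
      then have "x \<noteq> 0" using nonempty_Basis by fastforce
      have "gauge4 x powr d = (gauge4 x powr (Q / 4)) powr (- b)"
        using Q by (simp add: powr_powr b_def)
      also have "\<dots> \<le> (\<Prod>i\<in>Basis. \<bar>x \<bullet> i\<bar>) powr (- b)"
      proof (rule powr_mono2')
        show "0 < (\<Prod>i\<in>Basis. \<bar>x \<bullet> i\<bar>)" using x by (intro prod_pos) auto
        show "(\<Prod>i\<in>Basis. \<bar>x \<bullet> i\<bar>) \<le> gauge4 x powr (Q / 4)"
          unfolding Q_def by (rule prod_coordinates_le_gauge4[OF \<open>x \<noteq> 0\<close>])
      qed (use b in simp)
      also have "\<dots> = (\<Prod>i\<in>Basis. \<bar>x \<bullet> i\<bar> powr - b)"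
        by (rule prod_powr_distrib)
      finally show "\<bar>gauge4 x powr d\<bar> \<le> 1 * (\<Prod>i\<in>Basis. \<bar>x \<bullet> i\<bar> powr - b)" by simp
    qed
  qed
next
  case False
  \<comment> \<open>A continuous majorant is used since the power itself can jump: as
    \<open>0 powr 0 = 0\<close>, for d = 0 it equals 1 except at the identity.\<close>
  define n where "n = nat \<lceil>d\<rceil>"
  have n: "d \<le> real n" unfolding n_def by linarith
  have m: "(\<lambda>x::(real^'m) \<times> (real^'k). gauge4 x powr d) \<in> borel_measurable borel" by measurable
  show ?thesis
  proof (rule loc_integrable_bound[OF loc_integrable_continuous m, where C=1])
    show "continuous_on UNIV (\<lambda>x::(real^'m) \<times> (real^'k). 1 + gauge4 x ^ n)"
      by (intro continuous_intros continuous_on_gauge4)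
    show "AE x::(real^'m) \<times> (real^'k) in lborel. \<bar>gauge4 x powr d\<bar> \<le> 1 * (1 + gauge4 x ^ n)"
    proof (intro AE_I2)
      fix x :: "(real^'m) \<times> (real^'k)"
      have nn: "0 \<le> gauge4 x ^ n" by (simp add: gauge4_nonneg)
      show "\<bar>gauge4 x powr d\<bar> \<le> 1 * (1 + gauge4 x ^ n)"
      proof (cases "gauge4 x \<le> 1")
        case True
        then have "gauge4 x powr d \<le> 1"
          using False by (intro powr_le1) (auto simp: gauge4_nonneg)
        then show ?thesis using nn by simp
      next
        case gt: False
        then have "gauge4 x powr d \<le> gauge4 x powr real n" using n by (intro powr_mono) auto
        also have "\<dots> = gauge4 x ^ n" using gt by (intro powr_realpow) auto
        finally show ?thesis using nn by simp
      qed
    qed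
  qed
qed

text \<open>One component is bounded by the whole gradient, and 16|z|^2 w <= 16 w^(3/2). The power
  3/4 reflects dilation degree 3 against degree 4 for w.\<close>

lemma grad_gauge4_bound:
  assumes "heisenberg_type B"
  shows "\<bar>grad_gauge4 B i x\<bar> \<le> 4 * gauge4 x powr (3/4)"
proof -
  have "(grad_gauge4 B i x)\<^sup>2 \<le> (\<Sum>i\<in>UNIV. (grad_gauge4 B i x)\<^sup>2)"
    by (rule member_le_sum) auto
  also have "\<dots> = 16 * norm (fst x) ^ 2 * gauge4 x" by (rule sum_grad_gauge4_sq[OF assms])
  also have "\<dots> \<le> 16 * gauge4 x powr (1/2) * gauge4 x"
    by (intro mult_right_mono mult_left_mono norm_fst_sq_le_gauge4 gauge4_nonneg) auto
  also have "\<dots> = (4 * gauge4 x powr (3/4))\<^sup>2"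
    using powr_add[of "gauge4 x" "1/2" 1] powr_add[of "gauge4 x" "3/4" "3/4"] gauge4_nonneg[of x]
    by (simp add: power2_eq_square)
  finally show ?thesis
    by (simp only: abs_le_square_iff[symmetric]) simp
qed

text \<open>Every term is quadratic in z or linear in t, hence of dilation degree 2, which is half
  the degree of \<open>gauge4\<close>.\<close>

lemma hess_gauge4_bound:
  assumes "bilinear B"
  obtains C where "\<And>x i j. \<bar>hess_gauge4 B i j x\<bar> \<le> C * gauge4 x powr (1/2)"
proof -
  obtain K where K: "0 < K" "\<And>a b. norm (B a b) \<le> K * norm a * norm b"
    using bilinear_bounded_pos[OF assms] by blast
  have "\<bar>hess_gauge4 B i j x\<bar> \<le> (12 + 8 * K ^ 2 + 16 * K) * gauge4 x powr (1/2)" for x i j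
  proof -
    let ?z = "norm (fst x)"
    have 1: "\<bar>8 * fst x $ i * fst x $ j\<bar> \<le> 8 * ?z ^ 2"
      using mult_mono[OF component_le_norm_cart[of "fst x" i] component_le_norm_cart[of "fst x" j]]
      by (simp add: abs_mult power2_eq_square)
    have 2: "\<bar>4 * ?z ^ 2 * (if i = j then 1 else 0)\<bar> \<le> 4 * ?z ^ 2" by simp
    have b: "norm (B (fst x) (axis l 1)) \<le> K * ?z" for l
      using K(2)[of "fst x" "axis l 1"] by simp
    have "\<bar>B (fst x) (axis i 1) \<bullet> B (fst x) (axis j 1)\<bar> \<le> norm (B (fst x) (axis i 1)) * norm (B (fst x) (axis j 1))"
      by (rule Cauchy_Schwarz_ineq2)
    also have "\<dots> \<le> (K * ?z) * (K * ?z)"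
      using K(1) by (intro mult_mono b) auto
    finally have 3: "\<bar>8 * (B (fst x) (axis i 1) \<bullet> B (fst x) (axis j 1))\<bar> \<le> 8 * K ^ 2 * ?z ^ 2"
      by (simp add: power2_eq_square mult_ac)
    have "\<bar>B (axis j 1) (axis i 1) \<bullet> snd x\<bar> \<le> norm (B (axis j 1) (axis i 1)) * norm (snd x)"
      by (rule Cauchy_Schwarz_ineq2)
    also have "\<dots> \<le> K * norm (snd x)"
      using K(2)[of "axis j 1" "axis i 1"] by (intro mult_right_mono) auto
    finally have 4: "\<bar>16 * (B (axis j 1) (axis i 1) \<bullet> snd x)\<bar> \<le> 16 * K * norm (snd x)" by simp
    have "\<bar>hess_gauge4 B i j x\<bar> \<le> (12 + 8 * K ^ 2) * ?z ^ 2 + 16 * K * norm (snd x)"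
      using 1 2 3 4 unfolding hess_gauge4_def distrib_right abs_le_iff by linarith
    also have "\<dots> \<le> (12 + 8 * K ^ 2) * gauge4 x powr (1/2) + 16 * K * gauge4 x powr (1/2)"
      using K(1) by (intro add_mono mult_left_mono norm_fst_sq_le_gauge4 norm_snd_le_gauge4) auto
    finally show ?thesis by (simp add: algebra_simps)
  qed
  then show ?thesis using that by blast
qed

section \<open>Pointwise sign of the kernel\<close>

text \<open>With a = |v|^2 and q = p - 2 this is the coefficient matrix of the p-Laplacian with
  frozen gradient v. It splits a second-order form into its trace and its value on v.\<close>

lemma sum_delta_combination:
  fixes A :: "'m::finite \<Rightarrow> 'm \<Rightarrow> real"
  shows "(\<Sum>i\<in>UNIV. \<Sum>j\<in>UNIV. (a * (if i = j then 1 else 0) + q * v i * v j) * A i j)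
    = a * (\<Sum>i\<in>UNIV. A i i) + q * (\<Sum>i\<in>UNIV. \<Sum>j\<in>UNIV. A i j * v i * v j)"
proof -
  have "(\<Sum>j\<in>UNIV. (a * (if i = j then 1 else 0) + q * v i * v j) * A i j)
      = a * A i i + q * (\<Sum>j\<in>UNIV. A i j * v i * v j)" for i
  proof -
    have "(\<Sum>j\<in>UNIV. (a * (if i = j then 1 else 0) + q * v i * v j) * A i j)
      = (\<Sum>j\<in>UNIV. (if i = j then a * A i j else 0) + q * (A i j * v i * v j))"
      by (intro sum.cong) (auto simp: algebra_simps)
    then show ?thesis by (simp add: sum.distrib sum_distrib_left)
  qed
  then show ?thesis by (simp add: sum.distrib sum_distrib_left)
qed

text \<open>The bound is affine in \<open>s\<close>, so only \<open>s = 0\<close> and \<open>s = 4u\<close> matter; the latter is where the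
  hypothesis on the exponent enters.\<close>
lemma endpoint_bound:
  fixes s u q b r :: real
  assumes "0 \<le> s" "s \<le> 4 * u" "0 \<le> r" "0 \<le> q" "0 \<le> q + 2 * r * (2 * b - 1)"
  shows "0 \<le> u * q + r * (b - 1/2) * s"
proof (cases "1/2 \<le> b")
  case True
  then show ?thesis using assms by (intro add_nonneg_nonneg mult_nonneg_nonneg) auto
next
  case False
  have "r * (b - 1/2) * (4 * u) \<le> r * (b - 1/2) * s"
    using assms False by (intro mult_left_mono_neg mult_nonneg_nonpos) auto
  moreover have "0 \<le> u * (q + 2 * r * (2 * b - 1))"
    using assms by (intro mult_nonneg_nonneg) auto
  ultimately show ?thesis by (simp add: algebra_simps)
qed

text \<open>Write u = 4|z|^2|v|^2 w. The Hessian form times w is u + 8w(<z,v>^2 + |[z,v]|^2), and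
  the second summand dominates half of A^2. The other bound is Cauchy--Schwarz for the gradient and
  v, with |grad|^2 = 16|z|^2 w.\<close>

lemma hess_direction_bound:
  fixes B :: "real^'m \<Rightarrow> real^'m \<Rightarrow> real^'k"
  assumes ht: "heisenberg_type B"
  defines "A \<equiv> \<lambda>x v. \<Sum>i\<in>UNIV. grad_gauge4 B i x * v $ i"
  shows "4 * norm (fst x) ^ 2 * norm v ^ 2 * gauge4 x + (A x v)\<^sup>2 / 2
      \<le> gauge4 x * (\<Sum>i\<in>UNIV. \<Sum>j\<in>UNIV. hess_gauge4 B i j x * v $ i * v $ j)"
    and "(A x v)\<^sup>2 \<le> 4 * (4 * norm (fst x) ^ 2 * norm v ^ 2 * gauge4 x)"
proof -
  note B = heisenberg_typeD[OF ht]
  show "4 * norm (fst x) ^ 2 * norm v ^ 2 * gauge4 x + (A x v)\<^sup>2 / 2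
      \<le> gauge4 x * (\<Sum>i\<in>UNIV. \<Sum>j\<in>UNIV. hess_gauge4 B i j x * v $ i * v $ j)"
    using grad_gauge4_direction_bound[OF B(1), of x v]
    unfolding sum_hess_gauge4[OF B] A_def by (simp add: algebra_simps)
  have "(A x v)\<^sup>2 = ((\<chi> i. grad_gauge4 B i x) \<bullet> v)\<^sup>2"
    by (simp add: A_def inner_vec_def)
  also have "\<dots> \<le> norm (\<chi> i. grad_gauge4 B i x) ^ 2 * norm v ^ 2"
    using Cauchy_Schwarz_ineq[of "\<chi> i. grad_gauge4 B i x" v] by (simp add: power2_norm_eq_inner)
  also have "norm (\<chi> i. grad_gauge4 B i x) ^ 2 = 16 * norm (fst x) ^ 2 * gauge4 x"
    using norm_sq_sum[of "\<chi> i. grad_gauge4 B i x"] sum_grad_gauge4_sq[OF ht, of x] by simp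
  finally show "(A x v)\<^sup>2 \<le> 4 * (4 * norm (fst x) ^ 2 * norm v ^ 2 * gauge4 x)"
    by (simp add: mult_ac)
qed

text \<open>The trace contributes u(Q - 2 + 4b), with u = 4|z|^2|v|^2 w, and the value on v at least
  u + (b - 1/2)A^2. The total is affine in A^2 on [0, 4u]. The two hypotheses on Q, p and b say that
  it is nonnegative at the two ends.\<close>

lemma p_form_nonneg:
  fixes B :: "real^'m \<Rightarrow> real^'m \<Rightarrow> real^'k" and b p :: real
  assumes ht: "heisenberg_type B" and p: "2 \<le> p"
    and 1: "0 \<le> hom_dim B + p - 4 + 4 * b" and 2: "0 \<le> hom_dim B - p + 4 * b * (p - 1)"
  shows "0 \<le> (\<Sum>i\<in>UNIV. \<Sum>j\<in>UNIV. (norm v ^ 2 * (if i = j then 1 else 0) + (p - 2) * v $ i * v $ j)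
      * ((b - 1) * grad_gauge4 B i x * grad_gauge4 B j x + gauge4 x * hess_gauge4 B i j x))"
proof -
  let ?A = "\<Sum>i\<in>UNIV. grad_gauge4 B i x * v $ i"
  let ?H = "\<Sum>i\<in>UNIV. \<Sum>j\<in>UNIV. hess_gauge4 B i j x * v $ i * v $ j"
  let ?u = "4 * norm (fst x) ^ 2 * norm v ^ 2 * gauge4 x"
  have d: "(\<Sum>i\<in>UNIV. (b - 1) * grad_gauge4 B i x * grad_gauge4 B i x + gauge4 x * hess_gauge4 B i i x)
     = (b - 1) * (16 * norm (fst x) ^ 2 * gauge4 x) + gauge4 x * (4 * norm (fst x) ^ 2 * (hom_dim B + 2))"
    by (simp add: sum.distrib mult.assoc power2_eq_square[symmetric] sum_grad_gauge4_sq[OF ht] sum_hess_gauge4_diag[OF ht]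
        flip: sum_distrib_left)
  have q: "(\<Sum>i\<in>UNIV. \<Sum>j\<in>UNIV. ((b - 1) * grad_gauge4 B i x * grad_gauge4 B j x + gauge4 x * hess_gauge4 B i j x) * v $ i * v $ j)
     = (b - 1) * ?A\<^sup>2 + gauge4 x * ?H"
    by (simp only: power2_eq_square sum_product, simp only: sum_distrib_left sum.distrib[symmetric])
       (intro sum.cong refl, simp add: algebra_simps)
  have "0 \<le> ?u * (hom_dim B + p - 4 + 4 * b) + (p - 2) * (b - 1/2) * ?A\<^sup>2"
  proof (rule endpoint_bound)
    show "?A\<^sup>2 \<le> 4 * ?u" by (rule hess_direction_bound(2)[OF ht])
    show "0 \<le> hom_dim B + p - 4 + 4 * b + 2 * (p - 2) * (2 * b - 1)"
      using 2 by (simp add: algebra_simps)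
  qed (use p 1 in auto)
  also have "\<dots> = ?u * (hom_dim B - 2 + 4 * b) + (p - 2) * (?u + ?A\<^sup>2 / 2 + (b - 1) * ?A\<^sup>2)"
    by (simp add: field_simps)
  also have "\<dots> \<le> ?u * (hom_dim B - 2 + 4 * b) + (p - 2) * (gauge4 x * ?H + (b - 1) * ?A\<^sup>2)"
    using p by (intro add_left_mono mult_left_mono add_right_mono hess_direction_bound(1)[OF ht]) auto
  also have "\<dots> = norm v ^ 2 * ((b - 1) * (16 * norm (fst x) ^ 2 * gauge4 x) + gauge4 x * (4 * norm (fst x) ^ 2 * (hom_dim B + 2)))
      + (p - 2) * ((b - 1) * ?A\<^sup>2 + gauge4 x * ?H)"
    by (simp add: algebra_simps)
  finally show ?thesis
    unfolding sum_delta_combination d q .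
qed

text \<open>Only the value on v remains, as in the limit of large p. The end A^2 = 4u now asks for 1
  + 2(2b - 1) = 4b - 1 >= 0.\<close>

lemma inf_form_nonneg:
  fixes B :: "real^'m \<Rightarrow> real^'m \<Rightarrow> real^'k" and b :: real
  assumes ht: "heisenberg_type B" and b: "1 \<le> 4 * b"
  shows "0 \<le> (\<Sum>i\<in>UNIV. \<Sum>j\<in>UNIV. v $ i * v $ j
      * ((b - 1) * grad_gauge4 B i x * grad_gauge4 B j x + gauge4 x * hess_gauge4 B i j x))"
proof -
  let ?A = "\<Sum>i\<in>UNIV. grad_gauge4 B i x * v $ i"
  let ?H = "\<Sum>i\<in>UNIV. \<Sum>j\<in>UNIV. hess_gauge4 B i j x * v $ i * v $ j"
  let ?u = "4 * norm (fst x) ^ 2 * norm v ^ 2 * gauge4 x"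
  have q: "(\<Sum>i\<in>UNIV. \<Sum>j\<in>UNIV. v $ i * v $ j * ((b - 1) * grad_gauge4 B i x * grad_gauge4 B j x + gauge4 x * hess_gauge4 B i j x))
     = (b - 1) * ?A\<^sup>2 + gauge4 x * ?H"
    by (simp only: power2_eq_square sum_product, simp only: sum_distrib_left sum.distrib[symmetric])
       (intro sum.cong refl, simp add: algebra_simps)
  have "0 \<le> ?u * 1 + 1 * (b - 1/2) * ?A\<^sup>2"
  proof (rule endpoint_bound)
    show "?A\<^sup>2 \<le> 4 * ?u" by (rule hess_direction_bound(2)[OF ht])
  qed (use b in auto)
  moreover have "?u + ?A\<^sup>2 / 2 \<le> gauge4 x * ?H"
    by (rule hess_direction_bound(1)[OF ht])
  ultimately show ?thesis
    unfolding q by (simp add: algebra_simps)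
qed

text \<open>Where v is nonzero this is the chain rule. Where v vanishes, |v|^(p-2) need not be
  differentiable, but the difference quotient of the product is |v|^(p-2) times v_i/s: the first
  factor tends to 0 because p > 2, and the second converges.\<close>

lemma has_real_derivative_p_flux:
  fixes v :: "'m::finite \<Rightarrow> real \<Rightarrow> real"
  assumes d: "\<And>i. (v i has_real_derivative d i) (at 0)" and p: "2 < p"
  defines "n \<equiv> sqrt (\<Sum>j\<in>UNIV. (v j 0)\<^sup>2)"
  shows "((\<lambda>s. sqrt (\<Sum>j\<in>UNIV. (v j s)\<^sup>2) powr (p - 2) * v i s) has_real_derivative
      n powr (p - 2) * d i + (p - 2) * n powr (p - 4) * (\<Sum>j\<in>UNIV. v j 0 * d j) * v i 0) (at 0)"
proof -
  define S where "S = (\<lambda>s. \<Sum>j\<in>UNIV. (v j s)\<^sup>2)"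
  have Ss: "(\<Sum>j\<in>UNIV. (v j s)\<^sup>2) = S s" for s by (simp add: S_def)
  have S0: "0 \<le> S s" for s by (simp add: S_def sum_nonneg)
  have n: "n = sqrt (S 0)" by (simp add: n_def S_def)
  have dS: "(S has_real_derivative 2 * (\<Sum>j\<in>UNIV. v j 0 * d j)) (at 0)"
    unfolding S_def
    by (rule derivative_eq_intros d refl)+ (simp add: sum_distrib_left mult_ac)
  show ?thesis
  proof (cases "S 0 = 0")
    case False
    then have pos: "0 < S 0" using S0[of 0] by linarith
    then have npos: "0 < n" by (simp add: n)
    have dn: "((\<lambda>s. sqrt (S s)) has_real_derivative (\<Sum>j\<in>UNIV. v j 0 * d j) / n) (at 0)"
      using pos npos n by (auto intro!: derivative_eq_intros dS simp: field_simps)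
    from DERIV_fun_powr[OF dn, of "p - 2"] npos
    have "((\<lambda>s. sqrt (S s) powr (p - 2)) has_real_derivative (p - 2) * n powr (p - 3) * ((\<Sum>j\<in>UNIV. v j 0 * d j) / n)) (at 0)"
      by (simp add: n)
    moreover have "n powr (p - 3) = n * n powr (p - 4)"
      using npos powr_add[of n 1 "p - 4"] by simp
    ultimately have "((\<lambda>s. sqrt (S s) powr (p - 2)) has_real_derivative (p - 2) * n powr (p - 4) * (\<Sum>j\<in>UNIV. v j 0 * d j)) (at 0)"
      using npos by (simp add: mult_ac)
    from DERIV_mult[OF this d[of i]] show ?thesis
      by (simp add: Ss n algebra_simps)
  next
    case True
    then have v0: "v j 0 = 0" for j
      unfolding S_def by (simp add: sum_nonneg_eq_0_iff)
    have nz: "n = 0" using True by (simp add: n)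
    have "(S \<longlongrightarrow> S 0) (at 0)"
      using DERIV_isCont[OF dS] by (simp add: isCont_def)
    then have "((\<lambda>s. sqrt (S s)) \<longlongrightarrow> 0) (at 0)"
      using tendsto_real_sqrt[of S 0 "at 0"] True by simp
    then have 1: "((\<lambda>s. sqrt (S s) powr (p - 2)) \<longlongrightarrow> 0) (at 0)"
      by (rule tendsto_zero_powrI[OF _ tendsto_const]) (use p S0 in auto)
    have "((\<lambda>s. v i s / s) \<longlongrightarrow> d i) (at 0)"
      using d[of i] by (simp add: has_field_derivative_iff v0)
    from tendsto_mult[OF 1 this]
    have "((\<lambda>s. sqrt (S s) powr (p - 2) * v i s) has_real_derivative 0) (at 0)"
      by (simp add: has_field_derivative_iff v0)
    \<comment> \<open>The asserted formula also gives 0 here, because v vanishes at 0 and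
      \<open>0 powr a = 0\<close> for every a, in particular for negative p - 4.\<close>
    then show ?thesis by (simp add: S_def nz v0)
  qed
qed

section \<open>Potentials of gauge kernels\<close>

text \<open>The Riesz kernel \<open>N\<^sup>-\<^sup>\<alpha>\<close> is the case \<open>b = c = - \<alpha> / 4\<close>, the logarithmic kernel the case
  \<open>b = 0\<close>, \<open>c = 1 / 4\<close>.\<close>
locale gauge_potential =
  fixes B :: "real^'m \<Rightarrow> real^'m \<Rightarrow> real^'k"
    and \<rho> :: "(real^'m) \<times> (real^'k) \<Rightarrow> real"
    and f :: "real \<Rightarrow> real" and c b :: real
  assumes ht: "heisenberg_type B"
    and density_cont: "continuous_on UNIV \<rho>"
    and density_supp: "\<exists>K. compact K \<and> (\<forall>x. x \<notin> K \<longrightarrow> \<rho> x = 0)"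
    and density_nonneg: "0 \<le> \<rho> x"
    and deriv_f: "0 < w \<Longrightarrow> (f has_real_derivative c * w powr (b - 1)) (at w)"
    and loc_integrable_f: "loc_integrable (\<lambda>x::(real^'m) \<times> (real^'k). f (gauge4 x))"
    and exponent: "- (hom_dim B / 4) < b - 1/2"
begin

sublocale compactly_supported_density B \<rho>
proof
  show "bilinear B" by (rule heisenberg_typeD(1)[OF ht])
  show "B z z' = - B z' z" for z z' by (rule heisenberg_typeD(2)[OF ht])
qed (rule density_cont density_supp)+

definition "grad_kernel i x = c * gauge4 x powr (b - 1) * grad_gauge4 B i x"

text \<open>The power w^(b-2) is taken out of both chain-rule terms, which leaves a polynomial
  bracket that carries the sign.\<close>

definition "hess_kernel i j x = c * gauge4 x powr (b - 2) *
  ((b - 1) * grad_gauge4 B i x * grad_gauge4 B j x + gauge4 x * hess_gauge4 B i j x)"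

definition "F = potential B \<rho> (\<lambda>x. f (gauge4 x))"

lemma continuous_on_grad_gauge4: "continuous_on S (grad_gauge4 B i)"
  unfolding grad_gauge4_def
  by (intro continuous_on_add continuous_on_mult continuous_on_const continuous_on_power continuous_on_norm
      continuous_on_fst continuous_on_snd continuous_on_id continuous_on_component continuous_on_inner
      continuous_on_bilinear[OF bilinear])

lemma continuous_on_hess_gauge4: "continuous_on S (hess_gauge4 B i j)"
  unfolding hess_gauge4_def
  by (intro continuous_on_add continuous_on_diff continuous_on_mult continuous_on_const continuous_on_power continuous_on_norm
      continuous_on_fst continuous_on_snd continuous_on_id continuous_on_component continuous_on_inner
      continuous_on_bilinear[OF bilinear])

lemma borel_measurable_grad_hess [measurable]:
  "grad_gauge4 B i \<in> borel_measurable borel" "hess_gauge4 B i j \<in> borel_measurable borel"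
  by (intro borel_measurable_continuous_onI continuous_on_grad_gauge4 continuous_on_hess_gauge4)+

lemma continuous_on_grad_kernel: "continuous_on (- {0}) (grad_kernel i)"
  unfolding grad_kernel_def
  by (intro continuous_on_mult continuous_on_const continuous_on_powr continuous_on_gauge4 continuous_on_grad_gauge4)
     (use gauge4_pos in fastforce)

lemma continuous_on_hess_kernel: "continuous_on (- {0}) (hess_kernel i j)"
  unfolding hess_kernel_def
  by (intro continuous_on_mult continuous_on_add continuous_on_const continuous_on_powr continuous_on_gauge4
      continuous_on_grad_gauge4 continuous_on_hess_gauge4)
     (use gauge4_pos in fastforce)

lemma gmul_hexp_0: "gmul B (hexp i (- 0)) x = x"
  using bilinear_lzero[OF bilinear] by (simp add: gmul_def hexp_def)

lemma deriv_kernel: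
  assumes "x \<noteq> 0"
  shows "((\<lambda>s. f (gauge4 (gmul B (hexp i (- s)) x))) has_real_derivative grad_kernel i x) (at 0)"
proof -
  have "(f has_real_derivative c * gauge4 x powr (b - 1)) (at (gauge4 (gmul B (hexp i (- 0)) x)))"
    unfolding gmul_hexp_0 by (rule deriv_f[OF gauge4_pos[OF assms]])
  from DERIV_chain2[OF this has_derivative_gauge4[OF bilinear skew]] show ?thesis
    by (simp add: grad_kernel_def)
qed

lemma deriv_grad_kernel:
  assumes "x \<noteq> 0"
  shows "((\<lambda>s. grad_kernel i (gmul B (hexp i' (- s)) x)) has_real_derivative hess_kernel i i' x) (at 0)"
proof -
  have w: "0 < gauge4 x" by (rule gauge4_pos[OF assms])
  then have w0: "0 < gauge4 (gmul B (hexp i' (- 0)) x)" by (simp only: gmul_hexp_0)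
  have p: "gauge4 x powr (b - 1) = gauge4 x powr (b - 2) * gauge4 x"
    using powr_add[of "gauge4 x" "b - 2" 1] w by simp
  have "((\<lambda>s. gauge4 (gmul B (hexp i' (- s)) x) powr (b - 1)) has_real_derivative
      (b - 1) * gauge4 x powr (b - 2) * grad_gauge4 B i' x) (at 0)"
    using DERIV_fun_powr[OF has_derivative_gauge4[OF bilinear skew] w0, of "b - 1"]
    by (simp add: gmul_hexp_0[simplified])
  from DERIV_cmult[OF DERIV_mult[OF this has_derivative_grad_gauge4[OF bilinear skew, of i i' x]], of c]
  show ?thesis
    by (simp add: grad_kernel_def hess_kernel_def gmul_hexp_0[simplified] p algebra_simps)
qed

lemma exponent': "- (real (CARD('m) + 2 * CARD('k)) / 4) < b - 1/2"
  using exponent unfolding hom_dim_def .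

lemma loc_integrable_grad_kernel: "loc_integrable (grad_kernel i)"
proof (rule loc_integrable_bound)
  show "loc_integrable (\<lambda>x::(real^'m) \<times> (real^'k). gauge4 x powr (b - 1/4))"
    by (rule loc_integrable_gauge4_powr) (use exponent' in linarith)
  show "grad_kernel i \<in> borel_measurable borel" unfolding grad_kernel_def by measurable
  show "AE x in lborel. \<bar>grad_kernel i x\<bar> \<le> (4 * \<bar>c\<bar>) * gauge4 x powr (b - 1/4)"
  proof (intro AE_I2)
    fix x :: "(real^'m) \<times> (real^'k)"
    have "\<bar>grad_kernel i x\<bar> \<le> \<bar>c\<bar> * gauge4 x powr (b - 1) * (4 * gauge4 x powr (3/4))"
      unfolding grad_kernel_def abs_mult using grad_gauge4_bound[OF ht, of i x] by (intro mult_mono) auto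
    also have "gauge4 x powr (b - 1) * gauge4 x powr (3/4) = gauge4 x powr (b - 1/4)"
      by (simp flip: powr_add)
    then have "\<bar>c\<bar> * gauge4 x powr (b - 1) * (4 * gauge4 x powr (3/4)) = (4 * \<bar>c\<bar>) * gauge4 x powr (b - 1/4)"
      by (simp add: mult_ac)
    finally show "\<bar>grad_kernel i x\<bar> \<le> (4 * \<bar>c\<bar>) * gauge4 x powr (b - 1/4)" .
  qed
qed

text \<open>The bracket has size w^(3/2), so with the prefactor w^(b-2) the kernel has size
  w^(b-1/2). The assumption \<open>exponent\<close> puts this above the critical power -Q/4.\<close>

lemma loc_integrable_hess_kernel: "loc_integrable (hess_kernel i j)"
proof -
  obtain C where C: "\<And>x i j. \<bar>hess_gauge4 B i j x\<bar> \<le> C * gauge4 x powr (1/2)"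
    using hess_gauge4_bound[OF bilinear] by metis
  show ?thesis
  proof (rule loc_integrable_bound)
    show "loc_integrable (\<lambda>x::(real^'m) \<times> (real^'k). gauge4 x powr (b - 1/2))"
      by (rule loc_integrable_gauge4_powr) (rule exponent')
    show "hess_kernel i j \<in> borel_measurable borel" unfolding hess_kernel_def by measurable
    show "AE x in lborel. \<bar>hess_kernel i j x\<bar> \<le> (\<bar>c\<bar> * (\<bar>b - 1\<bar> * 16 + C)) * gauge4 x powr (b - 1/2)"
    proof (intro AE_I2)
      fix x :: "(real^'m) \<times> (real^'k)"
      let ?w = "gauge4 x"
      have e1: "?w powr (3/4) * ?w powr (3/4) = ?w powr (3/2)" by (simp flip: powr_add)
      have e2: "?w * ?w powr (1/2) = ?w powr (3/2)"
        using powr_add[of ?w 1 "1/2"] gauge4_nonneg[of x] by simp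
      have e3: "?w powr (b - 2) * ?w powr (3/2) = ?w powr (b - 1/2)" by (simp flip: powr_add)
      have "\<bar>(b - 1) * grad_gauge4 B i x * grad_gauge4 B j x\<bar> \<le> \<bar>b - 1\<bar> * (4 * ?w powr (3/4)) * (4 * ?w powr (3/4))"
        unfolding abs_mult using grad_gauge4_bound[OF ht, of _ x] by (intro mult_mono) auto
      moreover have "\<bar>?w * hess_gauge4 B i j x\<bar> \<le> ?w * (C * ?w powr (1/2))"
        unfolding abs_mult using C[of i j x] gauge4_nonneg[of x] by (intro mult_mono) auto
      moreover have "\<bar>b - 1\<bar> * (4 * ?w powr (3/4)) * (4 * ?w powr (3/4)) + ?w * (C * ?w powr (1/2))
          = (\<bar>b - 1\<bar> * 16 + C) * ?w powr (3/2)"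
        unfolding e1[symmetric] using e1 e2 by (simp add: algebra_simps)
      ultimately have *: "\<bar>(b - 1) * grad_gauge4 B i x * grad_gauge4 B j x + ?w * hess_gauge4 B i j x\<bar>
          \<le> (\<bar>b - 1\<bar> * 16 + C) * ?w powr (3/2)" by linarith
      have "\<bar>hess_kernel i j x\<bar> \<le> \<bar>c\<bar> * ?w powr (b - 2) * ((\<bar>b - 1\<bar> * 16 + C) * ?w powr (3/2))"
        unfolding hess_kernel_def abs_mult[of "c * _"] abs_mult[of c] using * by (intro mult_mono) auto
      also have "\<dots> = \<bar>c\<bar> * (\<bar>b - 1\<bar> * 16 + C) * (?w powr (b - 2) * ?w powr (3/2))" by (simp only: mult_ac)
      finally show "\<bar>hess_kernel i j x\<bar> \<le> (\<bar>c\<bar> * (\<bar>b - 1\<bar> * 16 + C)) * ?w powr (b - 1/2)"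
        unfolding e3 .
    qed
  qed
qed

section \<open>Horizontal derivatives of the potential and the sign of its p-Laplacian\<close>

lemma hcurve_eq: "hcurve B u g i = (\<lambda>s. u (gmul B g (hexp i s)))"
  by (simp add: hcurve_def hexp_def)

lemma deriv_F: "(hcurve B F g i has_real_derivative potential B \<rho> (grad_kernel i) g) (at 0)"
  unfolding hcurve_eq F_def
  by (rule has_real_derivative_potential[OF loc_integrable_f loc_integrable_grad_kernel continuous_on_grad_kernel deriv_kernel])

lemma Xf_F: "Xf B i F = potential B \<rho> (grad_kernel i)"
  using DERIV_imp_deriv[OF deriv_F] by (auto simp: Xf_def)

lemma deriv_XF: "(hcurve B (Xf B i F) g j has_real_derivative potential B \<rho> (hess_kernel i j) g) (at 0)"
  unfolding hcurve_eq Xf_F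
  by (rule has_real_derivative_potential[OF loc_integrable_grad_kernel loc_integrable_hess_kernel continuous_on_hess_kernel deriv_grad_kernel])

lemma Xf_Xf_F: "Xf B j (Xf B i F) g = potential B \<rho> (hess_kernel i j) g"
  using DERIV_imp_deriv[OF deriv_XF] by (simp only: Xf_def[of B j])

text \<open>The coefficients \<open>a\<close> do not depend on the integration variable, so the form
  passes under the integral, where the nonnegative density multiplies a pointwise form. The factor
  \<open>r\<close> carries the sign of the kernel.\<close>

lemma second_order_form_nonneg:
  assumes "\<And>x. x \<noteq> 0 \<Longrightarrow> 0 \<le> (\<Sum>i\<in>UNIV. \<Sum>j\<in>UNIV. a i j * (r * hess_kernel i j x))"
  shows "0 \<le> r * (\<Sum>i\<in>UNIV. \<Sum>j\<in>UNIV. a i j * potential B \<rho> (hess_kernel i j) g)"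
proof -
  have int: "integrable lborel (\<lambda>x. \<rho> (gmul B g x) * hess_kernel i j x)" for i j
    by (rule potential_integrable[OF loc_integrable_hess_kernel])
  have "r * (\<Sum>i\<in>UNIV. \<Sum>j\<in>UNIV. a i j * potential B \<rho> (hess_kernel i j) g)
      = (\<Sum>i\<in>UNIV. \<Sum>j\<in>UNIV. (\<integral>x. r * (a i j * (\<rho> (gmul B g x) * hess_kernel i j x)) \<partial>lborel))"
    by (simp add: potential_def sum_distrib_left)
  also have "\<dots> = (\<integral>x. (\<Sum>i\<in>UNIV. \<Sum>j\<in>UNIV. r * (a i j * (\<rho> (gmul B g x) * hess_kernel i j x))) \<partial>lborel)"
    by (simp add: Bochner_Integration.integral_sum int)
  also have "\<dots> = (\<integral>x. \<rho> (gmul B g x) * (\<Sum>i\<in>UNIV. \<Sum>j\<in>UNIV. a i j * (r * hess_kernel i j x)) \<partial>lborel)"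
    by (simp add: sum_distrib_left mult_ac)
  also have "0 \<le> \<dots>"
  proof (rule integral_nonneg_AE)
    show "AE x in lborel. 0 \<le> \<rho> (gmul B g x) * (\<Sum>i\<in>UNIV. \<Sum>j\<in>UNIV. a i j * (r * hess_kernel i j x))"
      using AE_snd_nonzero
    proof eventually_elim
      fix x :: "(real^'m) \<times> (real^'k)" assume "snd x \<noteq> 0"
      then have "x \<noteq> 0" by auto
      then show "0 \<le> \<rho> (gmul B g x) * (\<Sum>i\<in>UNIV. \<Sum>j\<in>UNIV. a i j * (r * hess_kernel i j x))"
        by (intro mult_nonneg_nonneg density_nonneg assms)
    qed
  qed
  finally show ?thesis .
qed

text \<open>Multiplying by \<open>c\<close> turns the constant of the kernel into a square, so
  kernels of both signs are treated at once.\<close>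

lemma kernel_form_nonneg:
  assumes "0 \<le> (\<Sum>i\<in>UNIV. \<Sum>j\<in>UNIV. a i j * ((b - 1) * grad_gauge4 B i x * grad_gauge4 B j x + gauge4 x * hess_gauge4 B i j x))"
  shows "0 \<le> (\<Sum>i\<in>UNIV. \<Sum>j\<in>UNIV. a i j * (c * hess_kernel i j x))"
proof -
  have "(\<Sum>i\<in>UNIV. \<Sum>j\<in>UNIV. a i j * (c * hess_kernel i j x)) = c * c * gauge4 x powr (b - 2) *
     (\<Sum>i\<in>UNIV. \<Sum>j\<in>UNIV. a i j * ((b - 1) * grad_gauge4 B i x * grad_gauge4 B j x + gauge4 x * hess_gauge4 B i j x))"
    unfolding sum_distrib_left by (intro sum.cong refl) (simp only: hess_kernel_def mult_ac)
  then show ?thesis using assms by simp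
qed

lemma deriv_flux:
  fixes g :: "(real^'m) \<times> (real^'k)"
  assumes p: "2 < p"
  defines "v \<equiv> \<chi> i. potential B \<rho> (grad_kernel i) g"
  shows "(hcurve B (p_flux B p F i) g i has_real_derivative
      norm v powr (p - 2) * potential B \<rho> (hess_kernel i i) g
      + (p - 2) * norm v powr (p - 4) * (\<Sum>j\<in>UNIV. v $ j * potential B \<rho> (hess_kernel j i) g) * v $ i) (at 0)"
proof -
  have 0: "gmul B g (hexp i 0) = g"
    using bilinear_rzero[OF bilinear] by (simp add: gmul_def hexp_def)
  have "((\<lambda>s. potential B \<rho> (grad_kernel j) (gmul B g (hexp i s))) has_real_derivative potential B \<rho> (hess_kernel j i) g) (at 0)" for j
    using deriv_XF[of j g i] by (simp add: hcurve_eq Xf_F)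
  from has_real_derivative_p_flux[where v="\<lambda>j s. potential B \<rho> (grad_kernel j) (gmul B g (hexp i s))", OF this p, of i]
  show ?thesis
    by (simp add: 0 v_def hcurve_eq p_flux_def hgrad_norm_def Xf_F norm_vec_def L2_set_def)
qed

lemma p_lap_F:
  fixes g :: "(real^'m) \<times> (real^'k)"
  assumes p: "2 < p"
  defines "v \<equiv> \<chi> i. potential B \<rho> (grad_kernel i) g"
  shows "p_lap B p F g = norm v powr (p - 4) *
    (\<Sum>i\<in>UNIV. \<Sum>j\<in>UNIV. (norm v ^ 2 * (if i = j then 1 else 0) + (p - 2) * v $ i * v $ j) * potential B \<rho> (hess_kernel i j) g)"
proof -
  \<comment> \<open>At v = 0 both sides vanish since \<open>0 powr a = 0\<close>, so critical points
    of the potential are no exception even for p < 4.\<close>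
  have e: "norm v powr (p - 2) = norm v powr (p - 4) * norm v ^ 2"
    using p powr_add[of "norm v" "p - 4" 2] by (cases "v = 0") (simp_all add: powr_realpow)
  have "p_lap B p F g = (\<Sum>i\<in>UNIV. norm v powr (p - 2) * potential B \<rho> (hess_kernel i i) g
      + (p - 2) * norm v powr (p - 4) * (\<Sum>j\<in>UNIV. v $ j * potential B \<rho> (hess_kernel j i) g) * v $ i)"
    unfolding p_lap_def Xf_def[of B _ "p_flux _ _ _ _"] v_def
    by (intro sum.cong refl DERIV_imp_deriv deriv_flux p)
  also have "\<dots> = norm v powr (p - 4) * (norm v ^ 2 * (\<Sum>i\<in>UNIV. potential B \<rho> (hess_kernel i i) g)
      + (p - 2) * (\<Sum>i\<in>UNIV. \<Sum>j\<in>UNIV. potential B \<rho> (hess_kernel j i) g * v $ j * v $ i))"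
    by (simp only: e sum.distrib sum_distrib_left sum_distrib_right distrib_left mult_ac)
  also have "(\<Sum>i\<in>UNIV. \<Sum>j\<in>UNIV. potential B \<rho> (hess_kernel j i) g * v $ j * v $ i)
      = (\<Sum>i\<in>UNIV. \<Sum>j\<in>UNIV. potential B \<rho> (hess_kernel i j) g * v $ i * v $ j)"
    by (rule sum.swap)
  finally show ?thesis by (simp only: sum_delta_combination)
qed

lemma p_lap_sign:
  assumes p: "2 < p" and 1: "0 \<le> hom_dim B + p - 4 + 4 * b" and 2: "0 \<le> hom_dim B - p + 4 * b * (p - 1)"
  shows "0 \<le> c * p_lap B p F g"
proof -
  define v where "v = (\<chi> i. potential B \<rho> (grad_kernel i) g)"
  have "0 \<le> c * (\<Sum>i\<in>UNIV. \<Sum>j\<in>UNIV. (norm v ^ 2 * (if i = j then 1 else 0) + (p - 2) * v $ i * v $ j) * potential B \<rho> (hess_kernel i j) g)"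
    by (intro second_order_form_nonneg kernel_form_nonneg p_form_nonneg ht 1 2) (use p in simp)
  from mult_nonneg_nonneg[OF powr_ge_zero this, of "norm v" "p - 4"] show ?thesis
    unfolding p_lap_F[OF p] v_def by (simp only: mult.left_commute[of c])
qed

lemma hdiff_F: "hdiff B i F g" "2 < p \<Longrightarrow> hdiff B i (p_flux B p F i) g" "hdiff B i (Xf B j F) g"
  unfolding hdiff_def using deriv_F deriv_flux deriv_XF real_differentiable_def by blast+

lemma p_superharmonic_F:
  assumes "2 < p" "0 \<le> hom_dim B + p - 4 + 4 * b" "0 \<le> hom_dim B - p + 4 * b * (p - 1)" "c < 0"
  shows "p_superharmonic B p F"
  unfolding p_superharmonic_def
  using hdiff_F(1,2) assms(1) p_lap_sign[OF assms(1-3)] \<open>c < 0\<close> by (simp add: zero_le_mult_iff)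

lemma p_subharmonic_F:
  assumes "2 < p" "0 \<le> hom_dim B + p - 4 + 4 * b" "0 \<le> hom_dim B - p + 4 * b * (p - 1)" "0 < c"
  shows "p_subharmonic B p F"
  unfolding p_subharmonic_def
  using hdiff_F(1,2) assms(1) p_lap_sign[OF assms(1-3)] \<open>0 < c\<close> by (simp add: zero_le_mult_iff)

lemma inf_subharmonic_F:
  assumes "1 \<le> 4 * b" "0 < c"
  shows "inf_subharmonic B F"
proof -
  have "0 \<le> inf_lap B F g" for g
  proof -
    define v where "v = (\<chi> i. potential B \<rho> (grad_kernel i) g)"
    let ?h = "\<lambda>i j. potential B \<rho> (hess_kernel i j) g"
    have "0 \<le> c * (\<Sum>i\<in>UNIV. \<Sum>j\<in>UNIV. v $ i * v $ j * ?h i j)"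
      by (intro second_order_form_nonneg kernel_form_nonneg inf_form_nonneg ht assms)
    then have 0: "0 \<le> (\<Sum>i\<in>UNIV. \<Sum>j\<in>UNIV. v $ i * v $ j * ?h i j)"
      using \<open>0 < c\<close> by (simp add: zero_le_mult_iff)
    \<comment> \<open>The coefficients \<open>v $ i * v $ j\<close> are symmetric, so symmetrizing
      the Hessian leaves the form unchanged: the two halves agree after swapping the sums.\<close>
    have "inf_lap B F g = (\<Sum>i\<in>UNIV. \<Sum>j\<in>UNIV. (1/2) * (v $ i * v $ j * ?h i j) + (1/2) * (v $ j * v $ i * ?h j i))"
      unfolding inf_lap_def by (intro sum.cong refl) (simp add: Xf_Xf_F[unfolded Xf_F] Xf_F v_def algebra_simps)
    also have "\<dots> = (1/2) * (\<Sum>i\<in>UNIV. \<Sum>j\<in>UNIV. v $ i * v $ j * ?h i j) + (1/2) * (\<Sum>i\<in>UNIV. \<Sum>j\<in>UNIV. v $ j * v $ i * ?h j i)"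
      by (simp only: sum.distrib sum_distrib_left)
    also have "(\<Sum>i\<in>UNIV. \<Sum>j\<in>UNIV. v $ j * v $ i * ?h j i) = (\<Sum>i\<in>UNIV. \<Sum>j\<in>UNIV. v $ i * v $ j * ?h i j)"
      by (rule sum.swap)
    finally show ?thesis using 0 by simp
  qed
  then show ?thesis
    unfolding inf_subharmonic_def using hdiff_F(1,3) by blast
qed

text \<open>Left invariance undoes the substitution g' = g x and recovers the form in which the
  potentials were introduced.\<close>

lemma F_eq_integral: "F g = (\<integral>y. \<rho> y * f (gauge4 (gmul B (ginv g) y)) \<partial>lborel)"
proof -
  have [measurable]: "(\<lambda>x::(real^'m) \<times> (real^'k). f (gauge4 x)) \<in> borel_measurable borel"
    using loc_integrable_f by (simp add: loc_integrable_def)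
  have "(\<lambda>y. \<rho> y * f (gauge4 (gmul B (ginv g) y))) \<in> borel_measurable borel"
    by measurable
  from integral_gmul[OF bilinear this, of g] show ?thesis
    by (simp add: F_def potential_def gmul_ginv_cancel(1)[OF bilinear skew])
qed

end

text \<open>Both layers have positive dimension. The consequence Q > 2 keeps the second derivatives
  of the logarithmic kernel locally integrable and makes p > 2 automatic when p >= Q.\<close>

lemma hom_dim_ge_3: "3 \<le> hom_dim (B :: real^'m \<Rightarrow> real^'m \<Rightarrow> real^'k)"
proof -
  have "0 < CARD('m)" "0 < CARD('k)" by simp_all
  then have "3 \<le> CARD('m) + 2 * CARD('k)" by linarith
  then show ?thesis unfolding hom_dim_def by linarith
qed

section \<open>The exponent ranges for the Riesz and logarithmic potentials\<close>

theorem theorem1p3: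
  fixes B :: "real^'m \<Rightarrow> real^'m \<Rightarrow> real^'k"
    and \<rho> :: "(real^'m) \<times> (real^'k) \<Rightarrow> real"
  assumes "heisenberg_type B"
    and "continuous_on UNIV \<rho>"
    and "\<exists>K. compact K \<and> (\<forall>x. x \<notin> K \<longrightarrow> \<rho> x = 0)"
    and "\<forall>x. \<rho> x \<ge> 0"
  shows "(\<forall>p \<alpha>. 2 < p \<and> p < hom_dim B \<and> 0 < \<alpha> \<and> \<alpha> \<le> (hom_dim B - p) / (p - 1)
            \<longrightarrow> p_superharmonic B p (F_alpha B \<rho> \<alpha>))
       \<and> (\<forall>p \<alpha>. hom_dim B < p \<and> \<alpha> < hom_dim B \<and> \<alpha> \<noteq> 0 \<and> - \<alpha> \<ge> (p - hom_dim B) / (p - 1)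
            \<longrightarrow> p_subharmonic B p (F_alpha B \<rho> \<alpha>))
       \<and> (\<forall>\<alpha>. \<alpha> < hom_dim B \<and> \<alpha> \<noteq> 0 \<and> - \<alpha> \<ge> 1 \<longrightarrow> inf_subharmonic B (F_alpha B \<rho> \<alpha>))
       \<and> p_subharmonic B (hom_dim B) (F_log B \<rho>)"
proof -
  let ?Q = "hom_dim B"
  note Q3 = hom_dim_ge_3[of B]
  \<comment> \<open>The condition \<alpha> + 2 < Q is \<open>exponent\<close> for b = -\<alpha>/4:
    two horizontal derivatives worsen the singularity from N^(-\<alpha>) to N^(-\<alpha>-2).\<close>
  have riesz: "gauge_potential B \<rho> (\<lambda>w. w powr (- \<alpha> / 4)) (- \<alpha> / 4) (- \<alpha> / 4)" if "\<alpha> + 2 < ?Q" for \<alpha>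
  proof
    show "0 \<le> \<rho> x" for x using assms(4) by blast
    show "((\<lambda>w. w powr (- \<alpha> / 4)) has_real_derivative (- \<alpha> / 4) * w powr (- \<alpha> / 4 - 1)) (at w)" if "0 < w" for w
      using DERIV_fun_powr[OF DERIV_ident that, of "- \<alpha> / 4"] by simp
    show "loc_integrable (\<lambda>x::(real^'m) \<times> (real^'k). gauge4 x powr (- \<alpha> / 4))"
      by (rule loc_integrable_gauge4_powr) (use that in \<open>simp add: hom_dim_def\<close>)
    show "- (?Q / 4) < - \<alpha> / 4 - 1/2" using that by simp
  qed (rule assms(1-3))+
  have F_alpha: "F_alpha B \<rho> \<alpha> = gauge_potential.F B \<rho> (\<lambda>w. w powr (- \<alpha> / 4))" if "\<alpha> + 2 < ?Q" for \<alpha>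
  proof
    fix g
    have "\<rho> y / gauge h powr \<alpha> = \<rho> y * gauge4 h powr (- \<alpha> / 4)" for y and h :: "(real^'m) \<times> (real^'k)"
      using powr_minus_divide[of "gauge4 h" "\<alpha> / 4"] by (simp add: gauge_powr)
    then show "F_alpha B \<rho> \<alpha> g = gauge_potential.F B \<rho> (\<lambda>w. w powr (- \<alpha> / 4)) g"
      unfolding gauge_potential.F_eq_integral[OF riesz[OF that]] F_alpha_def by (simp only:)
  qed
  have log: "gauge_potential B \<rho> (\<lambda>w. ln w / 4) (1 / 4) 0"
  proof
    show "0 \<le> \<rho> x" for x using assms(4) by blast
    show "((\<lambda>w. ln w / 4) has_real_derivative 1 / 4 * w powr (0 - 1)) (at w)" if "0 < w" for w :: real
      using that by (auto intro!: derivative_eq_intros simp: powr_minus_divide)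
    \<comment> \<open>The logarithm is dominated by a small positive power for large w and a small
      negative one for small w. The exponent -1/4 is admissible since Q > 1.\<close>
    show "loc_integrable (\<lambda>x::(real^'m) \<times> (real^'k). ln (gauge4 x) / 4)"
    proof (rule loc_integrable_bound)
      show "loc_integrable (\<lambda>x::(real^'m) \<times> (real^'k). gauge4 x powr (1/4) + gauge4 x powr (- 1/4))"
        by (intro loc_integrable_add loc_integrable_gauge4_powr) (use Q3 in \<open>simp_all add: hom_dim_def\<close>)
      show "(\<lambda>x::(real^'m) \<times> (real^'k). ln (gauge4 x) / 4) \<in> borel_measurable borel" by measurable
      show "AE x::(real^'m) \<times> (real^'k) in lborel. \<bar>ln (gauge4 x) / 4\<bar> \<le> 1 * (gauge4 x powr (1/4) + gauge4 x powr (- 1/4))"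
        using AE_lborel_singleton[of 0]
      proof eventually_elim
        fix x :: "(real^'m) \<times> (real^'k)" assume "x \<noteq> 0"
        then have w: "0 < gauge4 x" by (rule gauge4_pos)
        have "ln (gauge4 x powr a) \<le> gauge4 x powr a" for a
          using ln_le_minus_one[of "gauge4 x powr a"] w by simp
        from this[of "1/4"] this[of "- 1/4"] w
        have "ln (gauge4 x) / 4 \<le> gauge4 x powr (1/4)" "- (ln (gauge4 x) / 4) \<le> gauge4 x powr (- 1/4)"
          by (simp_all add: ln_powr)
        moreover have "0 \<le> gauge4 x powr (1/4)" "0 \<le> gauge4 x powr (- 1/4)" by simp_all
        ultimately show "\<bar>ln (gauge4 x) / 4\<bar> \<le> 1 * (gauge4 x powr (1/4) + gauge4 x powr (- 1/4))"
          unfolding mult_1 abs_le_iff by linarith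
      qed
    qed
    show "- (?Q / 4) < 0 - 1/2" using Q3 by simp
  qed (rule assms(1-3))+
  have F_log: "F_log B \<rho> = gauge_potential.F B \<rho> (\<lambda>w. ln w / 4)"
    by (rule ext) (simp add: gauge_potential.F_eq_integral[OF log] F_log_def ln_gauge)
  show ?thesis
  proof (intro conjI allI impI; (elim conjE)?)
    fix p \<alpha> :: real
    assume p: "2 < p" "p < ?Q" and \<alpha>: "0 < \<alpha>" "\<alpha> \<le> (?Q - p) / (p - 1)"
    have le: "\<alpha> * (p - 1) \<le> ?Q - p" using p \<alpha> by (simp add: pos_le_divide_eq)
    \<comment> \<open>As p - 1 > 1, one gets \<alpha> < \<alpha>(p - 1) <= Q - p < Q - 2, so the
      admissible range already ensures locally integrable second derivatives.\<close>
    have "\<alpha> * 1 < \<alpha> * (p - 1)" using p \<alpha> by (intro mult_strict_left_mono) auto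
    with le p have \<alpha>2: "\<alpha> + 2 < ?Q" by linarith
    show "p_superharmonic B p (F_alpha B \<rho> \<alpha>)"
      unfolding F_alpha[OF \<alpha>2]
      by (rule gauge_potential.p_superharmonic_F[OF riesz[OF \<alpha>2] p(1)]) (use p \<alpha> \<alpha>2 le in auto)
  next
    fix p \<alpha> :: real
    assume p: "?Q < p" and \<alpha>: "(p - ?Q) / (p - 1) \<le> - \<alpha>"
    \<comment> \<open>For p > Q the lower bound on -\<alpha> is positive, hence c = -\<alpha>/4 > 0
      and \<alpha> + 2 < 2 < Q.\<close>
    have "0 < (p - ?Q) / (p - 1)" using p Q3 by simp
    with \<alpha> have \<alpha>neg: "\<alpha> < 0" by linarith
    then have \<alpha>2: "\<alpha> + 2 < ?Q" using Q3 by linarith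
    have le: "p - ?Q \<le> - \<alpha> * (p - 1)" using p Q3 \<alpha> by (simp add: pos_divide_le_eq)
    show "p_subharmonic B p (F_alpha B \<rho> \<alpha>)"
      unfolding F_alpha[OF \<alpha>2]
      by (rule gauge_potential.p_subharmonic_F[OF riesz[OF \<alpha>2]]) (use p \<alpha>neg Q3 le in auto)
  next
    fix \<alpha> :: real
    assume \<alpha>: "1 \<le> - \<alpha>"
    then have \<alpha>2: "\<alpha> + 2 < ?Q" using Q3 by linarith
    show "inf_subharmonic B (F_alpha B \<rho> \<alpha>)"
      unfolding F_alpha[OF \<alpha>2]
      by (rule gauge_potential.inf_subharmonic_F[OF riesz[OF \<alpha>2]]) (use \<alpha> in auto)
  next
    \<comment> \<open>With b = 0 and p = Q the extreme condition Q - p + 4b(p - 1) >= 0 holds with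
      equality.\<close>
    show "p_subharmonic B ?Q (F_log B \<rho>)"
      unfolding F_log
      by (rule gauge_potential.p_subharmonic_F[OF log]) (use Q3 in auto)
  qed
qed

end
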